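(* Let $I,\overline J,\mathsf h$ be as in the context. If $T,T'$ are $(I,\overline J)$-trees such that $T'$ is obtained from $T$ by an increasing flip, then $\varphi(\mathsf g(T))<\varphi(\mathsf g(T'))$ for the linear functional $\varphi(x)=-\sum_{\overline j\in\overline J\setminus\{\overline j_{\max}\}}x_{\overline j}$. That is, $\varphi$ orients the edges of the $(I,\overline J)$-associahedron according to the covering relations of the $(I,\overline J)$-Tamari poset.
   Context: $\mathbb{N}=\{0,1,\dots\}$, $\overline{\mathbb{N}}$ a disjoint copy, totally ordered by $i\prec\overline i\prec i+1$. $I\subset\mathbb{N}$, $\overline J\subset\overline{\mathbb{N}}$ are nonempty finite with $\min(I\sqcup\overline J)\in I$ and $\overline j_{\max}:=\max(I\sqcup\overline J)\in\overline J$. An $(I,\overline J)$-tree is a maximal set of arcs $(i,\overline j)\in I\times\overline J$ with $i\le j$ for every arc and no two arcs $(i,\overline j),(i',\overline{j'})$ with $i<i'\le j<j'$ (it is a spanning tree of $K_{I,\overline J}$). An increasing flip replaces one arc $(i,\overline j)$ of a tree $T$ by an arc $(i',\overline{j'})$ with $i'>i,j'>j$, yielding a tree $T'$. $\mathsf h$ is a real function on $\{(i,\overline j): i\le j\}$ with $\mathsf h(i,\overline{j'})+\mathsf h(i',\overline j)<\mathsf h(i,\overline j)+\mathsf h(i',\overline{j'})$ whenever $i<i'\le j<j'$. For a tree $T$, $\mathsf g(T)\in\mathbb{R}^{\overline J\setminus\{\overline j_{\max}\}}$ has coordinates $\mathsf g(T)_{\overline k}=\sum\pm\mathsf h(i,\overline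 j)$, the sum over the arcs of the unique path in $T$ from $\overline k$ to $\overline j_{\max}$, with sign $+$ if the arc is traversed from $\overline j$ to $i$ and $-$ otherwise; these are the vertices of the $(I,\overline J)$-associahedron, the complex of bounded cells of the arrangement of inverted tropical hyperplanes $H_i=\{x:\max_{\overline j}(x_{\overline j}-\mathsf h(i,\overline j))$ attained twice$\}$ in the chart $x_{\overline j_{\max}}=0$ (with $\mathsf h=+\infty$ when $j<i$). *)

theory Defs
  imports Complex_Main
begin

text \<open>
  A subset of the barred copy of the naturals is represented by the set of its underlying
  numbers. As \<open>i \<prec> bar i \<prec> i + 1\<close>, we have \<open>i \<prec> bar j\<close> iff \<open>i \<le> j\<close>.
  The least element of the disjoint union of \<open>I\<close> and \<open>J\<close> hence lies in \<open>I\<close> iff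
  \<open>Min I \<le> Min J\<close>, its greatest element lies in \<open>J\<close> iff \<open>Max I \<le> Max J\<close>, and the latter is
  then \<open>bar (Max J)\<close>.
\<close>

definition admissible_pair :: "nat set \<Rightarrow> nat set \<Rightarrow> bool" where
  "admissible_pair I J \<longleftrightarrow>
     finite I \<and> I \<noteq> {} \<and> finite J \<and> J \<noteq> {} \<and> Min I \<le> Min J \<and> Max I \<le> Max J"

definition arcs :: "nat set \<Rightarrow> nat set \<Rightarrow> (nat \<times> nat) set" where
  "arcs I J = {(i, j). i \<in> I \<and> j \<in> J \<and> i \<le> j}"

definition noncrossing :: "(nat \<times> nat) set \<Rightarrow> bool" where
  "noncrossing T \<longleftrightarrow>
     \<not> (\<exists>i j i' j'. (i, j) \<in> T \<and> (i', j') \<in> T \<and> i < i' \<and> i' \<le> j \<and> j < j')"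

definition IJ_tree :: "nat set \<Rightarrow> nat set \<Rightarrow> (nat \<times> nat) set \<Rightarrow> bool" where
  "IJ_tree I J T \<longleftrightarrow>
     T \<subseteq> arcs I J \<and> noncrossing T \<and>
     (\<forall>S. T \<subseteq> S \<and> S \<subseteq> arcs I J \<and> noncrossing S \<longrightarrow> S = T)"

definition increasing_flip ::
    "nat set \<Rightarrow> nat set \<Rightarrow> (nat \<times> nat) set \<Rightarrow> (nat \<times> nat) set \<Rightarrow> bool" where
  "increasing_flip I J T T' \<longleftrightarrow>
     IJ_tree I J T \<and> IJ_tree I J T' \<and>
     (\<exists>i j i' j'. (i, j) \<in> T \<and> i < i' \<and> j < j' \<and> T' = insert (i', j') (T - {(i, j)}))"

definition tamari_le ::
    "nat set \<Rightarrow> nat set \<Rightarrow> (nat \<times> nat) set \<Rightarrow> (nat \<times> nat) set \<Rightarrow> bool" where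
  "tamari_le I J T T' \<longleftrightarrow>
     IJ_tree I J T \<and> IJ_tree I J T' \<and> (increasing_flip I J)\<^sup>*\<^sup>* T T'"

definition tamari_covers ::
    "nat set \<Rightarrow> nat set \<Rightarrow> (nat \<times> nat) set \<Rightarrow> (nat \<times> nat) set \<Rightarrow> bool" where
  "tamari_covers I J T T' \<longleftrightarrow>
     tamari_le I J T T' \<and> T \<noteq> T' \<and>
     (\<forall>S. tamari_le I J T S \<and> tamari_le I J S T' \<longrightarrow> S = T \<or> S = T')"

definition height_function :: "nat set \<Rightarrow> nat set \<Rightarrow> (nat \<Rightarrow> nat \<Rightarrow> real) \<Rightarrow> bool" where
  "height_function I J h \<longleftrightarrow>
     (\<forall>i\<in>I. \<forall>i'\<in>I. \<forall>j\<in>J. \<forall>j'\<in>J.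
        i < i' \<and> i' \<le> j \<and> j < j' \<longrightarrow> h i j' + h i' j < h i j + h i' j')"

text \<open>Vertices of the bipartite graph: \<open>Inl i\<close> is \<open>i\<close> and \<open>Inr j\<close> is \<open>bar j\<close>.\<close>

fun adjacent :: "(nat \<times> nat) set \<Rightarrow> nat + nat \<Rightarrow> nat + nat \<Rightarrow> bool" where
  "adjacent T (Inl i) (Inr j) \<longleftrightarrow> (i, j) \<in> T"
| "adjacent T (Inr j) (Inl i) \<longleftrightarrow> (i, j) \<in> T"
| "adjacent T _ _ \<longleftrightarrow> False"

definition is_path ::
    "(nat \<times> nat) set \<Rightarrow> nat + nat \<Rightarrow> nat + nat \<Rightarrow> (nat + nat) list \<Rightarrow> bool" where
  "is_path T u v p \<longleftrightarrow>
     p \<noteq> [] \<and> hd p = u \<and> last p = v \<and> distinct p \<and> successively (adjacent T) p"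

fun step_height :: "(nat \<Rightarrow> nat \<Rightarrow> real) \<Rightarrow> nat + nat \<Rightarrow> nat + nat \<Rightarrow> real" where
  "step_height h (Inr j) (Inl i) = h i j"
| "step_height h (Inl i) (Inr j) = - h i j"
| "step_height h _ _ = 0"

fun path_height :: "(nat \<Rightarrow> nat \<Rightarrow> real) \<Rightarrow> (nat + nat) list \<Rightarrow> real" where
  "path_height h (u # v # p) = step_height h u v + path_height h (v # p)"
| "path_height h _ = 0"

text \<open>
  Points of the real vector space with coordinates indexed by \<open>J - {Max J}\<close> are functions on
  \<open>nat\<close> that vanish outside this index set; in particular the coordinate at \<open>Max J\<close> is 0, as
  required by the chart in which the tropical hyperplanes are drawn.
\<close>

definition chart :: "nat set \<Rightarrow> (nat \<Rightarrow> real) set" where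
  "chart J = {x. \<forall>k. k \<notin> J - {Max J} \<longrightarrow> x k = 0}"

definition g_vec ::
    "nat set \<Rightarrow> (nat \<Rightarrow> nat \<Rightarrow> real) \<Rightarrow> (nat \<times> nat) set \<Rightarrow> (nat \<Rightarrow> real)" where
  "g_vec J h T =
     (\<lambda>k. if k \<in> J - {Max J}
          then path_height h (THE p. is_path T (Inr k) (Inr (Max J)) p) else 0)"

definition phi :: "nat set \<Rightarrow> (nat \<Rightarrow> real) \<Rightarrow> real" where
  "phi J x = - (\<Sum>k\<in>J - {Max J}. x k)"

text \<open>
  The indices \<open>j\<close> at which the maximum of \<open>x j - h i j\<close> is attained. Where \<open>j < i\<close>, the height
  is read as plus infinity, so that this term is never maximal: the term at \<open>Max J\<close> is finite.
  The inverted tropical hyperplane \<open>H_i\<close> is the set of points of the chart for which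
  \<open>max_terms J h i x\<close> has at least two elements.
\<close>

definition max_terms ::
    "nat set \<Rightarrow> (nat \<Rightarrow> nat \<Rightarrow> real) \<Rightarrow> nat \<Rightarrow> (nat \<Rightarrow> real) \<Rightarrow> nat set" where
  "max_terms J h i x =
     {j \<in> J. i \<le> j \<and> (\<forall>j'\<in>J. i \<le> j' \<longrightarrow> x j' - h i j' \<le> x j - h i j)}"

text \<open>
  Each \<open>H_i\<close> subdivides the chart into the relatively open cells on which \<open>max_terms J h i\<close> is
  constant; the arrangement induces the common refinement over all \<open>i \<in> I\<close>. The set
  \<open>cell_of I J h x\<close> is the closed cell whose relative interior contains \<open>x\<close>.
\<close>

definition cell_of ::
    "nat set \<Rightarrow> nat set \<Rightarrow> (nat \<Rightarrow> nat \<Rightarrow> real) \<Rightarrow> (nat \<Rightarrow> real) \<Rightarrow> (nat \<Rightarrow> real) set" where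
  "cell_of I J h x =
     {y \<in> chart J. \<forall>i\<in>I. max_terms J h i x \<subseteq> max_terms J h i y}"

definition bounded_points :: "(nat \<Rightarrow> real) set \<Rightarrow> bool" where
  "bounded_points C \<longleftrightarrow> (\<exists>B. \<forall>x\<in>C. \<forall>k. \<bar>x k\<bar> \<le> B)"

definition associahedron ::
    "nat set \<Rightarrow> nat set \<Rightarrow> (nat \<Rightarrow> nat \<Rightarrow> real) \<Rightarrow> (nat \<Rightarrow> real) set set" where
  "associahedron I J h = {cell_of I J h x | x. x \<in> chart J \<and> bounded_points (cell_of I J h x)}"

text \<open>The affine hull of \<open>C\<close> is a line.\<close>

definition one_dimensional :: "(nat \<Rightarrow> real) set \<Rightarrow> bool" where
  "one_dimensional C \<longleftrightarrow>
     (\<exists>a d. C \<subseteq> {(\<lambda>k. a k + t * d k) | t. True}) \<and> (\<exists>x\<in>C. \<exists>y\<in>C. x \<noteq> y)"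

definition associahedron_edges ::
    "nat set \<Rightarrow> nat set \<Rightarrow> (nat \<Rightarrow> nat \<Rightarrow> real) \<Rightarrow> (nat \<Rightarrow> real) set set" where
  "associahedron_edges I J h = {C \<in> associahedron I J h. one_dimensional C}"

text \<open>The library's \<open>closed_segment\<close> needs a real vector space type, which functions are not.\<close>

definition segment_between :: "(nat \<Rightarrow> real) \<Rightarrow> (nat \<Rightarrow> real) \<Rightarrow> (nat \<Rightarrow> real) set" where
  "segment_between x y = {(\<lambda>k. (1 - t) * x k + t * y k) | t. 0 \<le> t \<and> t \<le> 1}"

end

theory Submission
  imports Defs
begin

text \<open>
  Write a point of the chart together with the values of the maxima that define the hyperplanes as
  a potential on the nodes of the bipartite graph, so that the arcs at which the maxima are
  attained are those of slack 0. The inequality for \<open>h\<close> makes them a noncrossing set, hence a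
  forest since every arc of a noncrossing set is a bridge; conversely, an uncrossing argument shows
  that the potential of a tree has nonnegative slack everywhere, so the tight arcs at \<open>g(T)\<close> are
  exactly those of \<open>T\<close>.

  If \<open>(i, j)\<close> is flipped to \<open>(i', j')\<close>, then \<open>(i, j')\<close> and \<open>(i', j)\<close> lie in both trees, and
  \<open>i'\<close>, \<open>j\<close> lie on the side \<open>B\<close> of the removed arc away from the root. So the flip
  lowers the coordinates in \<open>B\<close> by the slack \<open>h(i,j) + h(i',j') - h(i,j') - h(i',j)\<close> of the new
  arc, which is positive; this is the claim on \<open>phi\<close>. The cell of the common arcs is the segment
  traversed.
  In a bounded cell of dimension 1 the tight arcs have exactly two components, and moving the
  one without root up and down until a new arc becomes tight gives two trees that differ in one
  arc. Finally, flips never decrease the largest neighbour of any \<open>i\<close>, which leaves no room for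
  a tree strictly between two trees related by a flip, so flips are exactly the covering relations.
\<close>

section \<open>Noncrossing sets are forests\<close>

lemma noncrossingD:
  "noncrossing T \<Longrightarrow> (i, j) \<in> T \<Longrightarrow> (i', j') \<in> T \<Longrightarrow> i < i' \<Longrightarrow> i' \<le> j \<Longrightarrow> j < j' \<Longrightarrow> False"
  unfolding noncrossing_def by blast

lemma noncrossing_subset: "noncrossing S \<Longrightarrow> T \<subseteq> S \<Longrightarrow> noncrossing T"
  unfolding noncrossing_def by blast

lemma adjacent_commute: "adjacent T u v \<longleftrightarrow> adjacent T v u"
  by (cases u; cases v) auto

lemma adjacentE:
  assumes "adjacent T u v"
  obtains i j where "(i, j) \<in> T" "u = Inl i" "v = Inr j"
    | i j where "(i, j) \<in> T" "u = Inr j" "v = Inl i"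
  using assms by (cases u; cases v) auto

text \<open>
  If \<open>i\<close> has a neighbour beyond \<open>j\<close>, this contains all nodes on the side of \<open>bar j\<close> when the arc
  \<open>(i, j)\<close> is removed from \<open>T\<close>.
\<close>

definition inner_side :: "(nat \<times> nat) set \<Rightarrow> nat \<Rightarrow> nat \<Rightarrow> (nat + nat) set" where
  "inner_side T i j =
     Inl ` {a. i < a \<and> a \<le> j \<and> (\<forall>b. (i, b) \<in> T \<and> b < j \<longrightarrow> b < a)} \<union>
     Inr ` {d. i \<le> d \<and> d \<le> j \<and> (\<forall>b. (i, b) \<in> T \<and> b < j \<longrightarrow> b < d)}"

lemma inner_side_simps [simp]:
  "Inl a \<in> inner_side T i j \<longleftrightarrow> i < a \<and> a \<le> j \<and> (\<forall>b. (i, b) \<in> T \<and> b < j \<longrightarrow> b < a)"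
  "Inr d \<in> inner_side T i j \<longleftrightarrow> i \<le> d \<and> d \<le> j \<and> (\<forall>b. (i, b) \<in> T \<and> b < j \<longrightarrow> b < d)"
  unfolding inner_side_def by auto

text \<open>An arc leaving the side through its left end would cross \<open>(i, j)\<close>. An arc
  entering it by its right end would cross \<open>(i, j')\<close> if it starts before
  \<open>i\<close>, and an arc \<open>(i, b)\<close> with \<open>b < j\<close> if it starts after
  \<open>i\<close> but not beyond \<open>b\<close>; starting at \<open>i\<close> itself forces
  \<open>d = j\<close>.\<close>

lemma inner_side_cut:
  assumes nc: "noncrossing T" and ij: "(i, j) \<in> T" and ij': "(i, j') \<in> T" "j < j'"
    and cd: "(c, d) \<in> T" "c \<le> d" "(c, d) \<noteq> (i, j)"
  shows "Inl c \<in> inner_side T i j \<longleftrightarrow> Inr d \<in> inner_side T i j"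
proof
  assume c: "Inl c \<in> inner_side T i j"
  then have "d \<le> j"
    using noncrossingD[OF nc ij cd(1)] by force
  with c cd show "Inr d \<in> inner_side T i j"
    by fastforce
next
  assume d: "Inr d \<in> inner_side T i j"
  have "\<not> c < i"
    using noncrossingD[OF nc cd(1) ij'(1)] d ij' by auto
  moreover have "c \<noteq> i"
    using d cd by (metis inner_side_simps(2) le_neq_implies_less less_irrefl)
  moreover have "b < c" if b: "(i, b) \<in> T" "b < j" for b
    using noncrossingD[OF nc b(1) cd(1)] d b calculation by force
  ultimately show "Inl c \<in> inner_side T i j"
    using d cd by auto
qed

text \<open>Complementary case, where \<open>j\<close> is the largest neighbour of \<open>i\<close>.
  The two conditions describe the side of \<open>i\<close>: it reaches from \<open>i\<close> to just
  before the next left neighbour of \<open>bar j\<close>, and contains \<open>i\<close> but not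
  \<open>bar j\<close>.\<close>

lemma outer_cut:
  assumes nc: "noncrossing T" and ij: "(i, j) \<in> T" and top: "\<And>b. (i, b) \<in> T \<Longrightarrow> b \<le> j"
    and cd: "(c, d) \<in> T" "c \<le> d" "(c, d) \<noteq> (i, j)"
  shows "i \<le> c \<and> c \<le> j \<and> (\<forall>a. (a, j) \<in> T \<and> i < a \<longrightarrow> c < a) \<longleftrightarrow>
         i \<le> d \<and> d < j \<and> (\<forall>a. (a, j) \<in> T \<and> i < a \<longrightarrow> d < a)"
    (is "?C \<longleftrightarrow> ?D")
proof
  assume C: ?C
  have "\<not> j < d"
    using noncrossingD[OF nc ij cd(1)] top[of d] C cd
    by (metis le_neq_implies_less not_less)
  moreover have "d \<noteq> j"
    using C cd by (metis le_neq_implies_less less_irrefl)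
  moreover have "d < a" if "(a, j) \<in> T" "i < a" for a
    using noncrossingD[OF nc cd(1) that(1)] C that calculation by force
  ultimately show ?D
    using C cd by auto
next
  assume D: ?D
  then have "\<not> c < i"
    using noncrossingD[OF nc cd(1) ij] by auto
  with D cd show ?C
    by fastforce
qed

text \<open>Being a bridge is expressed by a set \<open>A\<close> of nodes that separates the ends
  of the arc and is respected by all other arcs. Which side of the cut has an explicit description
  depends on whether \<open>i\<close> has a neighbour beyond \<open>j\<close>.\<close>

lemma noncrossing_bridge_arc:
  assumes nc: "noncrossing T" and le: "\<And>a b. (a, b) \<in> T \<Longrightarrow> a \<le> b" and ij: "(i, j) \<in> T"
  obtains A where "(Inl i \<in> A) \<noteq> (Inr j \<in> A)"
    "\<And>c d. (c, d) \<in> T \<Longrightarrow> (c, d) \<noteq> (i, j) \<Longrightarrow> Inl c \<in> A \<longleftrightarrow> Inr d \<in> A"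
proof (cases "\<exists>j'. (i, j') \<in> T \<and> j < j'")
  case True
  then obtain j' where "(i, j') \<in> T" "j < j'" by blast
  from inner_side_cut[OF nc ij this] le ij show thesis
    by (intro that[of "inner_side T i j"]) auto
next
  case False
  then have top: "\<And>b. (i, b) \<in> T \<Longrightarrow> b \<le> j" by force
  define A where "A = Inl ` {c. i \<le> c \<and> c \<le> j \<and> (\<forall>a. (a, j) \<in> T \<and> i < a \<longrightarrow> c < a)} \<union>
    Inr ` {d. i \<le> d \<and> d < j \<and> (\<forall>a. (a, j) \<in> T \<and> i < a \<longrightarrow> d < a)}"
  have A: "Inl c \<in> A \<longleftrightarrow> i \<le> c \<and> c \<le> j \<and> (\<forall>a. (a, j) \<in> T \<and> i < a \<longrightarrow> c < a)"
    "Inr c \<in> A \<longleftrightarrow> i \<le> c \<and> c < j \<and> (\<forall>a. (a, j) \<in> T \<and> i < a \<longrightarrow> c < a)" for c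
    unfolding A_def by auto
  show thesis
  proof (rule that)
    show "(Inl i \<in> A) \<noteq> (Inr j \<in> A)"
      using le[OF ij] by (auto simp: A)
    show "Inl c \<in> A \<longleftrightarrow> Inr d \<in> A" if "(c, d) \<in> T" "(c, d) \<noteq> (i, j)" for c d
      unfolding A by (rule outer_cut[OF nc ij top that(1) le[OF that(1)] that(2)])
  qed
qed

lemma noncrossing_bridge:
  assumes nc: "noncrossing T" and le: "\<And>a b. (a, b) \<in> T \<Longrightarrow> a \<le> b" and uv: "adjacent T u v"
  obtains A where "(u \<in> A) \<noteq> (v \<in> A)"
    "\<And>c d. adjacent T c d \<Longrightarrow> {c, d} \<noteq> {u, v} \<Longrightarrow> c \<in> A \<longleftrightarrow> d \<in> A"
proof -
  obtain i j where ij: "(i, j) \<in> T" "{u, v} = {Inl i, Inr j}"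
    using uv by (cases rule: adjacentE) auto
  obtain A where A: "(Inl i \<in> A) \<noteq> (Inr j \<in> A)"
    "\<And>c d. (c, d) \<in> T \<Longrightarrow> (c, d) \<noteq> (i, j) \<Longrightarrow> Inl c \<in> A \<longleftrightarrow> Inr d \<in> A"
    using noncrossing_bridge_arc[OF nc le ij(1)] by blast
  show thesis
  proof (rule that)
    show "(u \<in> A) \<noteq> (v \<in> A)"
      using ij(2) A(1) by (metis doubleton_eq_iff)
    fix c d assume "adjacent T c d" "{c, d} \<noteq> {u, v}"
    then show "c \<in> A \<longleftrightarrow> d \<in> A"
      by (cases rule: adjacentE) (use A(2) ij(2) in \<open>auto simp: insert_commute\<close>)
  qed
qed

section \<open>Existence and uniqueness of paths\<close>

lemma is_path_Cons:
  "adjacent T u v \<Longrightarrow> is_path T v w p \<Longrightarrow> u \<notin> set p \<Longrightarrow> is_path T u w (u # p)"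
  unfolding is_path_def by (auto simp: successively_Cons)

lemma is_path_suffix:
  assumes "is_path T v w p" "u \<in> set p"
  obtains q r where "p = q @ u # r" "is_path T u w (u # r)"
proof -
  obtain q r where p: "p = q @ u # r"
    using assms(2) by (meson split_list)
  have "is_path T u w (u # r)"
    using assms(1) unfolding is_path_def p by (auto simp: successively_append_iff)
  with p that show thesis by blast
qed

text \<open>A walk that avoids \<open>u\<close> never uses the arc between \<open>u\<close> and
  \<open>v\<close>, the only one that may leave \<open>A\<close>.\<close>

lemma successively_adjacent_invariant:
  assumes "successively (adjacent T) p" "u \<notin> set p" "x \<in> set p"
    and "\<And>c d. adjacent T c d \<Longrightarrow> {c, d} \<noteq> {u, v} \<Longrightarrow> c \<in> A \<longleftrightarrow> d \<in> A"
  shows "x \<in> A \<longleftrightarrow> hd p \<in> A"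
  using assms(1-3)
proof (induction p)
  case (Cons a p)
  show ?case
  proof (cases "x = a")
    case False
    then have "x \<in> set p" "p \<noteq> []" using Cons.prems by auto
    with Cons have "x \<in> A \<longleftrightarrow> hd p \<in> A" "adjacent T a (hd p)" "{a, hd p} \<noteq> {u, v}"
      by (auto simp: successively_Cons doubleton_eq_iff)
    with assms(4) show ?thesis by auto
  qed simp
qed simp

text \<open>If the paths leave \<open>u\<close> by different arcs, cut at the first arc of
  \<open>p\<close>. Both tails avoid \<open>u\<close> and end in \<open>v\<close>, so
  \<open>p1\<close> and \<open>q1\<close> are on the same side; but \<open>q1\<close> is adjacent to
  \<open>u\<close> on the other side.\<close>

lemma is_path_unique:
  assumes nc: "noncrossing T" and le: "\<And>a b. (a, b) \<in> T \<Longrightarrow> a \<le> b"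
    and "is_path T u v p" "is_path T u v q"
  shows "p = q"
  using assms(3,4)
proof (induction p arbitrary: u q)
  case Nil
  then show ?case by (simp add: is_path_def)
next
  case (Cons a p)
  then have a: "a = u" by (simp add: is_path_def)
  from Cons.prems(2) obtain q' where q: "q = u # q'"
    by (cases q) (auto simp: is_path_def)
  show ?case
  proof (cases "p = [] \<or> q' = []")
    case True
    then show ?thesis
      using Cons.prems a q by (auto simp: is_path_def split: if_splits)
  next
    case False
    then obtain p1 ps q1 qs where p: "p = p1 # ps" and q': "q' = q1 # qs"
      by (meson list.exhaust)
    have P: "is_path T p1 v p" "adjacent T u p1" "u \<notin> set p" "v \<in> set p"
      using Cons.prems(1) a p by (auto simp: is_path_def)
    have Q: "is_path T q1 v q'" "adjacent T u q1" "u \<notin> set q'" "v \<in> set q'"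
      using Cons.prems(2) q q' by (auto simp: is_path_def)
    have "p1 = q1"
    proof (rule ccontr)
      assume ne: "p1 \<noteq> q1"
      obtain A where A: "(u \<in> A) \<noteq> (p1 \<in> A)"
        "\<And>c d. adjacent T c d \<Longrightarrow> {c, d} \<noteq> {u, p1} \<Longrightarrow> c \<in> A \<longleftrightarrow> d \<in> A"
        using noncrossing_bridge[OF nc le P(2)] by blast
      have "v \<in> A \<longleftrightarrow> p1 \<in> A"
        using successively_adjacent_invariant[OF _ P(3,4) A(2)] P(1) p
        by (auto simp: is_path_def)
      moreover have "v \<in> A \<longleftrightarrow> q1 \<in> A"
        using successively_adjacent_invariant[OF _ Q(3,4) A(2)] Q(1) q'
        by (auto simp: is_path_def)
      moreover have "u \<in> A \<longleftrightarrow> q1 \<in> A"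
        using A(2)[OF Q(2)] ne by (auto simp: doubleton_eq_iff)
      ultimately show False using A(1) by blast
    qed
    then have "p = q'"
      using Cons.IH[OF P(1)] Q(1) by simp
    then show ?thesis using a q by simp
  qed
qed

lemma reachable_path:
  assumes "(adjacent T)\<^sup>*\<^sup>* u v"
  shows "\<exists>p. is_path T u v p"
  using assms
proof (induction rule: converse_rtranclp_induct)
  case base
  show ?case by (intro exI[of _ "[v]"]) (simp add: is_path_def)
next
  case (step u w)
  then obtain p where "is_path T w v p" by blast
  with step.hyps(1) show ?case
    by (metis is_path_Cons is_path_suffix)
qed

text \<open>The type of \<open>f\<close> is left open because the lemma serves both for membership
  in a cut and for the difference of two potentials.\<close>

lemma reachable_invariant:
  assumes "(adjacent T)\<^sup>*\<^sup>* u v" "\<And>i j. (i, j) \<in> T \<Longrightarrow> f (Inl i) = f (Inr j)"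
  shows "f u = f v"
  using assms(1)
  by (induction rule: rtranclp_induct) (use assms(2) in \<open>auto elim!: adjacentE\<close>)

lemma reachable_commute: "(adjacent T)\<^sup>*\<^sup>* u v \<Longrightarrow> (adjacent T)\<^sup>*\<^sup>* v u"
proof (induction rule: rtranclp_induct)
  case (step y z)
  then show ?case
    by (metis adjacent_commute converse_rtranclp_into_rtranclp)
qed simp

section \<open>Trees and increasing flips\<close>

definition node_set :: "nat set \<Rightarrow> nat set \<Rightarrow> (nat + nat) set" where
  "node_set I J = Inl ` I \<union> Inr ` J"

text \<open>Connectedness only, seen from the root \<open>bar (Max J)\<close>; acyclicity comes from
  \<open>noncrossing\<close>.\<close>

definition spanning :: "nat set \<Rightarrow> nat set \<Rightarrow> (nat \<times> nat) set \<Rightarrow> bool" where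
  "spanning I J T \<longleftrightarrow> (\<forall>v\<in>node_set I J. (adjacent T)\<^sup>*\<^sup>* v (Inr (Max J)))"

lemma IJ_tree_arcs: "IJ_tree I J T \<Longrightarrow> T \<subseteq> arcs I J"
  and IJ_tree_noncrossing: "IJ_tree I J T \<Longrightarrow> noncrossing T"
  unfolding IJ_tree_def by auto

lemma arcs_le: "T \<subseteq> arcs I J \<Longrightarrow> (a, b) \<in> T \<Longrightarrow> a \<le> b"
  unfolding arcs_def by auto

text \<open>Maximality in usable form: the last two premises exclude the two ways in which an arc of
  \<open>T\<close> can cross \<open>(a, b)\<close>.\<close>

lemma IJ_tree_memI:
  assumes "IJ_tree I J T" "a \<in> I" "b \<in> J" "a \<le> b"
    and "\<And>c d. (c, d) \<in> T \<Longrightarrow> c < a \<Longrightarrow> a \<le> d \<Longrightarrow> d < b \<Longrightarrow> False"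
    and "\<And>c d. (c, d) \<in> T \<Longrightarrow> a < c \<Longrightarrow> c \<le> b \<Longrightarrow> b < d \<Longrightarrow> False"
  shows "(a, b) \<in> T"
proof -
  have "noncrossing (insert (a, b) T)"
    using assms(5,6) IJ_tree_noncrossing[OF assms(1)] unfolding noncrossing_def by blast
  moreover have "insert (a, b) T \<subseteq> arcs I J"
    using assms(2-4) IJ_tree_arcs[OF assms(1)] unfolding arcs_def by auto
  ultimately show ?thesis
    using assms(1) unfolding IJ_tree_def by blast
qed

text \<open>An additional arc of a noncrossing \<open>S\<close> would be a bridge of
  \<open>S\<close>, although its ends are already connected inside \<open>T\<close>.\<close>

lemma spanning_IJ_tree:
  assumes T: "T \<subseteq> arcs I J" "noncrossing T" and span: "spanning I J T"
  shows "IJ_tree I J T"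
  unfolding IJ_tree_def
proof (intro conjI T allI impI)
  fix S assume S: "T \<subseteq> S \<and> S \<subseteq> arcs I J \<and> noncrossing S"
  show "S = T"
  proof (rule ccontr)
    assume "S \<noteq> T"
    then obtain i j where ij: "(i, j) \<in> S" "(i, j) \<notin> T" using S by auto
    have nc: "noncrossing S" and sub: "S \<subseteq> arcs I J" using S by simp_all
    obtain A where A: "(Inl i \<in> A) \<noteq> (Inr j \<in> A)"
      "\<And>c d. (c, d) \<in> S \<Longrightarrow> (c, d) \<noteq> (i, j) \<Longrightarrow> Inl c \<in> A \<longleftrightarrow> Inr d \<in> A"
      using noncrossing_bridge_arc[OF nc arcs_le[OF sub] ij(1)] by blast
    have inv: "Inl c \<in> A \<longleftrightarrow> Inr d \<in> A" if "(c, d) \<in> T" for c d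
    proof (rule A(2))
      show "(c, d) \<in> S" using that S by auto
      show "(c, d) \<noteq> (i, j)" using that ij(2) by auto
    qed
    have "(v \<in> A) = (Inr (Max J) \<in> A)" if "v \<in> node_set I J" for v
    proof (rule reachable_invariant[where f = "\<lambda>v. v \<in> A", OF _ inv])
      show "(adjacent T)\<^sup>*\<^sup>* v (Inr (Max J))"
        using span that unfolding spanning_def by simp
    qed
    moreover have "Inl i \<in> node_set I J" "Inr j \<in> node_set I J"
      using S ij unfolding node_set_def arcs_def by auto
    ultimately show False using A(1) by blast
  qed
qed

section \<open>The shape of an increasing flip\<close>

text \<open>For finite sets this compares the largest neighbours of each left node, without
  mentioning maxima that may not exist.\<close>

definition dominated :: "(nat \<times> nat) set \<Rightarrow> (nat \<times> nat) set \<Rightarrow> bool" where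
  "dominated T T' \<longleftrightarrow> (\<forall>a b. (a, b) \<in> T \<longrightarrow> (\<exists>b'\<ge>b. (a, b') \<in> T'))"

text \<open>If the exchanged arcs did not cross, the new one could be added to \<open>T\<close>. As
  they cross, every arc of \<open>T\<close> that crosses \<open>(i, j')\<close> or
  \<open>(i', j)\<close> also crosses \<open>(i, j)\<close> or \<open>(i', j')\<close>,
  contradicting that \<open>T\<close> and \<open>T'\<close> are noncrossing; so maximality puts both
  arcs into \<open>T\<close>.\<close>

lemma increasing_flipE:
  assumes "increasing_flip I J T T'"
  obtains i j i' j' where "IJ_tree I J T" "IJ_tree I J T'"
    "(i, j) \<in> T" "(i, j') \<in> T" "(i', j) \<in> T" "(i', j') \<notin> T"
    "i < i'" "i' \<le> j" "j < j'" "T' = insert (i', j') (T - {(i, j)})"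
proof -
  obtain i j i' j' where T: "IJ_tree I J T" and T': "IJ_tree I J T'" and ij: "(i, j) \<in> T"
    and lt: "i < i'" "j < j'" and T'_eq: "T' = insert (i', j') (T - {(i, j)})"
    using assms unfolding increasing_flip_def by blast
  note nc = noncrossingD[OF IJ_tree_noncrossing[OF T]]
  note nc' = noncrossingD[OF IJ_tree_noncrossing[OF T']]
  have in_arcs: "(i, j) \<in> arcs I J" "(i', j') \<in> arcs I J"
    using IJ_tree_arcs[OF T] IJ_tree_arcs[OF T'] ij T'_eq by auto
  have new: "(i', j') \<notin> T"
  proof
    assume "(i', j') \<in> T"
    then have "T' \<subseteq> T" "T' \<noteq> T" using T'_eq lt ij by auto
    then show False
      using T T' unfolding IJ_tree_def by blast
  qed
  have common: "(c, d) \<in> T'" if "(c, d) \<in> T" "(c, d) \<noteq> (i, j)" for c d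
    using that T'_eq by auto
  have new': "(i', j') \<in> T'" using T'_eq by auto
  have cross: "i' \<le> j"
  proof (rule ccontr)
    assume far: "\<not> i' \<le> j"
    have "(i', j') \<in> T"
    proof (rule IJ_tree_memI[OF T])
      show "False" if "(c, d) \<in> T" "c < i'" "i' \<le> d" "d < j'" for c d
        using nc'[OF common new'] that far by auto
      show "False" if "(c, d) \<in> T" "i' < c" "c \<le> j'" "j' < d" for c d
        using nc'[OF new' common] that lt by auto
    qed (use in_arcs in \<open>auto simp: arcs_def\<close>)
    with new show False by contradiction
  qed
  have 1: "(i, j') \<in> T"
  proof (rule IJ_tree_memI[OF T])
    show "False" if cd: "(c, d) \<in> T" "c < i" "i \<le> d" "d < j'" for c d
    proof (cases "d < j")
      case True
      with nc[OF cd(1) ij] cd show ?thesis by auto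
    next
      case False
      with nc'[OF common[OF cd(1)] new'] cd lt cross show ?thesis by auto
    qed
    show "False" if cd: "(c, d) \<in> T" "i < c" "c \<le> j'" "j' < d" for c d
    proof (cases "i' < c")
      case True
      with nc'[OF new' common[OF cd(1)]] cd lt show ?thesis by auto
    next
      case False
      with nc[OF ij cd(1)] cd lt cross show ?thesis by auto
    qed
  qed (use in_arcs lt in \<open>auto simp: arcs_def\<close>)
  have 2: "(i', j) \<in> T"
  proof (rule IJ_tree_memI[OF T])
    show "False" if cd: "(c, d) \<in> T" "c < i'" "i' \<le> d" "d < j" for c d
      using nc'[OF common[OF cd(1)] new'] cd lt by auto
    show "False" if cd: "(c, d) \<in> T" "i' < c" "c \<le> j" "j < d" for c d
      using nc[OF ij cd(1)] cd lt by auto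
  qed (use in_arcs cross in \<open>auto simp: arcs_def\<close>)
  show thesis
    by (rule that[OF T T' ij 1 2 new lt(1) cross lt(2) T'_eq])
qed

lemma increasing_flip_trees: "increasing_flip I J T T' \<Longrightarrow> IJ_tree I J T \<and> IJ_tree I J T'"
  unfolding increasing_flip_def by blast

lemma dominated_trans: "dominated T S \<Longrightarrow> dominated S U \<Longrightarrow> dominated T U"
  unfolding dominated_def by (meson order_trans)

lemma increasing_flip_dominated:
  assumes "increasing_flip I J T T'"
  shows "dominated T T'"
  unfolding dominated_def
proof (intro allI impI)
  fix a b assume ab: "(a, b) \<in> T"
  obtain i j i' j' where "(i, j') \<in> T" "j < j'" "T' = insert (i', j') (T - {(i, j)})"
    using assms by (rule increasing_flipE)
  then show "\<exists>b'\<ge>b. (a, b') \<in> T'"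
    using ab by (cases "(a, b) = (i, j)") (auto intro: exI[of _ j'])
qed

lemma increasing_flips_dominated: "(increasing_flip I J)\<^sup>*\<^sup>* T T' \<Longrightarrow> dominated T T'"
proof (induction rule: rtranclp_induct)
  case base
  show ?case unfolding dominated_def by blast
next
  case (step S U)
  then show ?case using dominated_trans increasing_flip_dominated by blast
qed

text \<open>Domination makes both flips raise the same left node: \<open>c' = i'\<close>.
  Noncrossing then determines the remaining three ends.\<close>

lemma increasing_flip_unique:
  assumes flip: "increasing_flip I J T T'" and flip1: "increasing_flip I J T S"
    and dom: "dominated S T'"
  shows "S = T'"
proof -
  obtain i j i' j' where T: "IJ_tree I J T" and T': "IJ_tree I J T'"
    and e: "(i, j) \<in> T" "(i, j') \<in> T" "(i', j) \<in> T" "(i', j') \<notin> T"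
    and lt: "i < i'" "i' \<le> j" "j < j'" and T'_eq: "T' = insert (i', j') (T - {(i, j)})"
    using flip by (rule increasing_flipE)
  obtain c d c' d' where e1: "(c, d) \<in> T" "(c, d') \<in> T" "(c', d) \<in> T" "(c', d') \<notin> T"
    and lt1: "c < c'" "c' \<le> d" "d < d'" and S_eq: "S = insert (c', d') (T - {(c, d)})"
    using flip1 by (rule increasing_flipE)
  note nc = noncrossingD[OF IJ_tree_noncrossing[OF T]]
  note nc' = noncrossingD[OF IJ_tree_noncrossing[OF T']]
  obtain b where b: "d' \<le> b" "(c', b) \<in> T'"
    using dom S_eq unfolding dominated_def by blast
  \<comment> \<open>The arc \<open>(c, d)\<close> of \<open>T\<close> crosses every arc from
    \<open>c'\<close> that ends beyond \<open>d\<close>. Hence \<open>(c', b)\<close> must be the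
    new arc of \<open>T'\<close>.\<close>
  have "(c', b) \<notin> T"
    using nc[OF e1(1)] lt1 b by force
  then have c': "c' = i'" "b = j'" using b T'_eq by auto
  have "\<not> d < j" using nc[OF e1(1) e(3)] lt1 c' by auto
  moreover have "\<not> j < d" using nc[OF e(1) e1(3)] lt c' by auto
  ultimately have d: "d = j" by simp
  have "\<not> c < i" using nc[OF e1(1) e(2)] lt d by auto
  moreover have "\<not> i < c" using nc[OF e(1) e1(2)] lt1 d by auto
  ultimately have c: "c = i" by simp
  have "\<not> d' < j'"
    using nc'[of i d' i' j'] e1(2) c d T'_eq lt lt1 by auto
  with b c' have "d' = j'" by simp
  with c c' d T'_eq S_eq show ?thesis by simp
qed

locale height_data =
  fixes I J :: "nat set" and h :: "nat \<Rightarrow> nat \<Rightarrow> real"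
  assumes adm: "admissible_pair I J" and hgt: "height_function I J h"
begin

lemma finite_I: "finite I" and finite_J: "finite J" and Max_J_in: "Max J \<in> J"
  and Min_I_in: "Min I \<in> I"
  using adm unfolding admissible_pair_def by auto

lemma le_Max: "j \<in> J \<Longrightarrow> j \<le> Max J"
  using finite_J by auto

lemma I_le_Max: "i \<in> I \<Longrightarrow> i \<le> Max J"
  using adm finite_I unfolding admissible_pair_def by (meson Max_ge order_trans)

lemma Min_le: "j \<in> J \<Longrightarrow> Min I \<le> j"
  using adm finite_J unfolding admissible_pair_def by (meson Min_le order_trans)

lemma finite_arcs: "finite (arcs I J)"
  by (rule finite_subset[of _ "I \<times> J"]) (use finite_I finite_J in \<open>auto simp: arcs_def\<close>)

section \<open>Trees are connected\<close>

lemma root_arc: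
  assumes "IJ_tree I J T"
  shows "(Min I, Max J) \<in> T"
  using IJ_tree_arcs[OF assms] le_Max finite_I
  by (intro IJ_tree_memI[OF assms Min_I_in Max_J_in Min_le[OF Max_J_in]])
    (force simp: arcs_def dest: Min.coboundedI)+

text \<open>Take the largest left node \<open>a \<le> j\<close> that has a neighbour beyond
  \<open>j\<close>: an arc crossing \<open>(a, j)\<close> would either cross the arc from
  \<open>a\<close> beyond \<open>j\<close> or yield a larger such node.\<close>

lemma tree_parent:
  assumes T: "IJ_tree I J T" and j: "j \<in> J" "j < Max J"
  shows "\<exists>a b. (a, j) \<in> T \<and> (a, b) \<in> T \<and> j < b"
proof -
  note nc = noncrossingD[OF IJ_tree_noncrossing[OF T]]
  define K where "K = {a \<in> I. a \<le> j \<and> (\<exists>b>j. (a, b) \<in> T)}"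
  have "finite K" "K \<noteq> {}"
    using finite_I root_arc[OF T] Min_I_in Min_le[OF j(1)] j(2) unfolding K_def by auto
  then have a: "Max K \<in> K" "\<And>c. c \<in> K \<Longrightarrow> c \<le> Max K" by auto
  define a where "a = Max K"
  obtain b where b: "a \<in> I" "a \<le> j" "j < b" "(a, b) \<in> T"
    using a(1) unfolding K_def a_def by blast
  have "(a, j) \<in> T"
  proof (rule IJ_tree_memI[OF T b(1) j(1) b(2)])
    show False if "(c, d) \<in> T" "c < a" "a \<le> d" "d < j" for c d
      using nc[OF that(1) b(4)] that b by auto
    show False if "(c, d) \<in> T" "a < c" "c \<le> j" "j < d" for c d
    proof -
      have "c \<in> K" using that IJ_tree_arcs[OF T] unfolding K_def arcs_def by auto
      with a(2) that(2) show False unfolding a_def by force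
    qed
  qed
  with b show ?thesis by blast
qed

text \<open>The mirror image of \<open>tree_parent\<close>: \<open>i\<close> can be joined to the
  smallest \<open>b \<ge> i\<close> that has a neighbour to the left of \<open>i\<close>.\<close>

lemma tree_left_nonempty:
  assumes T: "IJ_tree I J T" and i: "i \<in> I"
  shows "\<exists>j. (i, j) \<in> T"
proof (cases "i = Min I")
  case True
  then show ?thesis using root_arc[OF T] by blast
next
  case False
  then have "Min I < i" using i finite_I by (simp add: order_le_neq_trans)
  note nc = noncrossingD[OF IJ_tree_noncrossing[OF T]]
  define K where "K = {b \<in> J. i \<le> b \<and> (\<exists>a<i. (a, b) \<in> T)}"
  have "finite K" "K \<noteq> {}"
    using finite_J root_arc[OF T] Max_J_in I_le_Max[OF i] \<open>Min I < i\<close> unfolding K_def by auto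
  then have j: "Min K \<in> K" "\<And>c. c \<in> K \<Longrightarrow> Min K \<le> c" by auto
  define j where "j = Min K"
  obtain a where a: "j \<in> J" "i \<le> j" "a < i" "(a, j) \<in> T"
    using j(1) unfolding K_def j_def by blast
  have "(i, j) \<in> T"
  proof (rule IJ_tree_memI[OF T i a(1,2)])
    show False if "(c, d) \<in> T" "c < i" "i \<le> d" "d < j" for c d
    proof -
      have "d \<in> K" using that IJ_tree_arcs[OF T] unfolding K_def arcs_def by auto
      with j(2) that(4) show False unfolding j_def by force
    qed
    show False if "(c, d) \<in> T" "i < c" "c \<le> j" "j < d" for c d
      using nc[OF a(4) that(1)] that a by auto
  qed
  then show ?thesis by blast
qed

text \<open>By \<open>tree_parent\<close>, two arcs lead from any right node below the root to a
  larger right node; this is iterated up to the root.\<close>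

lemma tree_spanning:
  assumes T: "IJ_tree I J T"
  shows "spanning I J T"
proof -
  have J: "(adjacent T)\<^sup>*\<^sup>* (Inr j) (Inr (Max J))" if "j \<in> J" for j
    using that
  proof (induction "Max J - j" arbitrary: j rule: less_induct)
    case less
    show ?case
    proof (cases "j = Max J")
      case False
      with less.prems le_Max have "j < Max J" by (simp add: order_le_neq_trans)
      then obtain a b where ab: "(a, j) \<in> T" "(a, b) \<in> T" "j < b"
        using tree_parent[OF T less.prems] by blast
      have "b \<in> J" using ab IJ_tree_arcs[OF T] unfolding arcs_def by auto
      with less.hyps ab \<open>j < Max J\<close> have "(adjacent T)\<^sup>*\<^sup>* (Inr b) (Inr (Max J))" by simp
      moreover have "adjacent T (Inr j) (Inl a)" "adjacent T (Inl a) (Inr b)"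
        using ab by auto
      ultimately show ?thesis
        by (meson converse_rtranclp_into_rtranclp)
    qed simp
  qed
  have "(adjacent T)\<^sup>*\<^sup>* (Inl i) (Inr (Max J))" if i: "i \<in> I" for i
  proof -
    obtain j where j: "(i, j) \<in> T" using tree_left_nonempty[OF T i] by blast
    then have "j \<in> J" using IJ_tree_arcs[OF T] unfolding arcs_def by auto
    with J j show ?thesis
      by (meson adjacent.simps(1) converse_rtranclp_into_rtranclp)
  qed
  with J show ?thesis unfolding spanning_def node_set_def by auto
qed

section \<open>Potentials and tight arcs\<close>

text \<open>
  A potential \<open>f\<close> consists of a point \<open>f \<circ> Inr\<close> and of candidate values \<open>f \<circ> Inl\<close> for the maxima
  defining the tropical hyperplanes.
\<close>

definition slack :: "(nat + nat \<Rightarrow> real) \<Rightarrow> nat \<Rightarrow> nat \<Rightarrow> real" where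
  "slack f i j = f (Inl i) + h i j - f (Inr j)"

definition feasible :: "(nat + nat \<Rightarrow> real) \<Rightarrow> bool" where
  "feasible f \<longleftrightarrow> (\<forall>(i, j)\<in>arcs I J. 0 \<le> slack f i j)"

text \<open>All the sets \<open>max_terms\<close> at once, as a bipartite graph; inclusion of these
  graphs is the face relation of the arrangement.\<close>

definition tight :: "(nat \<Rightarrow> real) \<Rightarrow> (nat \<times> nat) set" where
  "tight x = {(i, j). i \<in> I \<and> j \<in> max_terms J h i x}"

text \<open>The least feasible extension of \<open>x\<close> to the nodes in \<open>I\<close>.
  Restricting the maximum to \<open>i \<le> j\<close> reflects the infinite height
  elsewhere.\<close>

definition lift :: "(nat \<Rightarrow> real) \<Rightarrow> nat + nat \<Rightarrow> real" where
  "lift x = case_sum (\<lambda>i. Max ((\<lambda>j. x j - h i j) ` {j \<in> J. i \<le> j})) x"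

lemma height_less:
  "(i, j) \<in> arcs I J \<Longrightarrow> (i', j') \<in> arcs I J \<Longrightarrow> i < i' \<Longrightarrow> i' \<le> j \<Longrightarrow> j < j' \<Longrightarrow>
    h i j' + h i' j < h i j + h i' j'"
  using hgt unfolding height_function_def arcs_def by auto

text \<open>Both sides involve the same four nodes, so the values of \<open>f\<close> cancel and the
  inequality for \<open>h\<close> remains.\<close>

lemma slack_less:
  "(i, j) \<in> arcs I J \<Longrightarrow> (i', j') \<in> arcs I J \<Longrightarrow> i < i' \<Longrightarrow> i' \<le> j \<Longrightarrow> j < j' \<Longrightarrow>
    slack f i j' + slack f i' j < slack f i j + slack f i' j'"
  using height_less[of i j i' j'] unfolding slack_def by simp

lemma tight_arcs: "tight x \<subseteq> arcs I J"
  unfolding tight_def max_terms_def arcs_def by auto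

text \<open>Exchanging the right ends of two crossing tight arcs would contradict the strict
  inequality for \<open>h\<close>: optimality at \<open>i\<close> and at \<open>i'\<close> adds up
  to its negation.\<close>

lemma tight_noncrossing: "noncrossing (tight x)"
  unfolding noncrossing_def
proof (intro notI, elim exE conjE)
  fix i j i' j'
  assume *: "(i, j) \<in> tight x" "(i', j') \<in> tight x" "i < i'" "i' \<le> j" "j < j'"
  then have "x j' - h i j' \<le> x j - h i j" "x j - h i' j \<le> x j' - h i' j'"
    unfolding tight_def max_terms_def by auto
  moreover have "h i j' + h i' j < h i j + h i' j'"
    using * tight_arcs by (intro height_less) auto
  ultimately show False by simp
qed

lemma lift_Inr [simp]: "lift x (Inr j) = x j"
  unfolding lift_def by simp

lemma
  assumes "i \<in> I"
  shows lift_attained: "\<exists>j. (i, j) \<in> arcs I J \<and> slack (lift x) i j = 0"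
    and lift_upper: "(i, j) \<in> arcs I J \<Longrightarrow> 0 \<le> slack (lift x) i j"
proof -
  let ?V = "(\<lambda>j. x j - h i j) ` {j \<in> J. i \<le> j}"
  have V: "finite ?V" "?V \<noteq> {}"
    using finite_J Max_J_in I_le_Max[OF assms] by auto
  from Max_in[OF V] obtain k where "k \<in> J" "i \<le> k" "lift x (Inl i) = x k - h i k"
    unfolding lift_def by auto
  then show "\<exists>j. (i, j) \<in> arcs I J \<and> slack (lift x) i j = 0"
    using assms unfolding slack_def arcs_def by auto
  assume "(i, j) \<in> arcs I J"
  then have "x j - h i j \<in> ?V" unfolding arcs_def by auto
  with V(1) have "x j - h i j \<le> Max ?V" by (rule Max_ge)
  then show "0 \<le> slack (lift x) i j"
    unfolding slack_def lift_def by simp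
qed

lemma feasible_lift: "feasible (lift x)"
  using lift_upper unfolding feasible_def arcs_def by auto

text \<open>Feasibility makes \<open>f (Inl i)\<close> an upper bound of all terms at
  \<open>i\<close>; an arc of slack 0 at \<open>i\<close> shows that the bound is attained, so it is
  the maximum.\<close>

lemma tight_iff:
  assumes f: "feasible f" and x: "\<And>j. j \<in> J \<Longrightarrow> x j = f (Inr j)"
    and i: "\<exists>j. (i, j) \<in> arcs I J \<and> slack f i j = 0"
  shows "(i, j) \<in> tight x \<longleftrightarrow> (i, j) \<in> arcs I J \<and> slack f i j = 0"
proof
  obtain k where k: "(i, k) \<in> arcs I J" "slack f i k = 0" using i by blast
  {
    assume ij: "(i, j) \<in> tight x"
    then have "x k - h i k \<le> x j - h i j"
      using k unfolding tight_def max_terms_def arcs_def by auto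
    moreover have "0 \<le> slack f i j" "(i, j) \<in> arcs I J"
      using ij tight_arcs[of x] f unfolding feasible_def by auto
    ultimately show "(i, j) \<in> arcs I J \<and> slack f i j = 0"
      using k x unfolding slack_def arcs_def by auto
  }
  assume ij: "(i, j) \<in> arcs I J \<and> slack f i j = 0"
  have "x j' - h i j' \<le> x j - h i j" if "j' \<in> J" "i \<le> j'" for j'
  proof -
    have "0 \<le> slack f i j'"
      using f that ij unfolding feasible_def arcs_def by auto
    with ij x that show ?thesis unfolding slack_def arcs_def by auto
  qed
  with ij show "(i, j) \<in> tight x"
    unfolding tight_def max_terms_def arcs_def by auto
qed

lemma tight_lift: "(i, j) \<in> tight x \<longleftrightarrow> (i, j) \<in> arcs I J \<and> slack (lift x) i j = 0"
proof (cases "i \<in> I")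
  case True
  then show ?thesis
    by (intro tight_iff feasible_lift lift_attained) simp_all
next
  case False
  then show ?thesis unfolding tight_def arcs_def by auto
qed

lemma tight_left_nonempty: "i \<in> I \<Longrightarrow> \<exists>j. (i, j) \<in> tight x"
  using lift_attained[of i x] tight_lift by blast

lemma cell_of_eq: "cell_of I J h x = {y \<in> chart J. tight x \<subseteq> tight y}"
  unfolding cell_of_def tight_def by auto

text \<open>The shift \<open>w\<close> is constant along tight arcs, so these keep slack 0 and every
  left node keeps a term attaining its maximum. Remaining in the closed cell is thereby reduced to
  feasibility.\<close>

lemma shift_cell:
  assumes w: "\<And>i j. (i, j) \<in> tight x \<Longrightarrow> w (Inl i) = w (Inr j)"
    and feas: "feasible (\<lambda>v. lift x v + w v)" and y: "\<And>j. j \<in> J \<Longrightarrow> y j = x j + w (Inr j)"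
  shows "(i, j) \<in> tight y \<longleftrightarrow> (i, j) \<in> arcs I J \<and> slack (\<lambda>v. lift x v + w v) i j = 0"
    and "tight x \<subseteq> tight y"
proof -
  have *: "slack (\<lambda>v. lift x v + w v) i j = slack (lift x) i j + w (Inl i) - w (Inr j)" for i j
    unfolding slack_def by simp
  have **: "slack (\<lambda>v. lift x v + w v) i j = 0" "(i, j) \<in> arcs I J"
    if "(i, j) \<in> tight x" for i j
    using that * w[OF that] tight_lift[of i j x] by auto
  have main: "(i, j) \<in> tight y \<longleftrightarrow> (i, j) \<in> arcs I J \<and> slack (\<lambda>v. lift x v + w v) i j = 0" for i j
  proof (cases "i \<in> I")
    case True
    then show ?thesis
      using tight_left_nonempty ** y by (intro tight_iff feas) (simp_all, metis)
  next
    case False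
    then show ?thesis unfolding tight_def arcs_def by auto
  qed
  then show "(i, j) \<in> tight y \<longleftrightarrow> (i, j) \<in> arcs I J \<and> slack (\<lambda>v. lift x v + w v) i j = 0" .
  show "tight x \<subseteq> tight y"
    using main ** by auto
qed

section \<open>The potential of a tree\<close>

text \<open>Extends the path sums of \<open>g_vec\<close> to the nodes in \<open>I\<close>, where
  they give the candidate maxima.\<close>

definition potential :: "(nat \<times> nat) set \<Rightarrow> nat + nat \<Rightarrow> real" where
  "potential T v = path_height h (THE p. is_path T v (Inr (Max J)) p)"

lemma path_height_potential:
  assumes "IJ_tree I J T" "is_path T v (Inr (Max J)) p"
  shows "potential T v = path_height h p"
proof -
  have "(THE p. is_path T v (Inr (Max J)) p) = p"
    using assms is_path_unique[OF IJ_tree_noncrossing[OF assms(1)]]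
      arcs_le[OF IJ_tree_arcs[OF assms(1)]] by blast
  then show ?thesis unfolding potential_def by simp
qed

lemma potential_root: "IJ_tree I J T \<Longrightarrow> potential T (Inr (Max J)) = 0"
  using path_height_potential[of T "Inr (Max J)" "[Inr (Max J)]"] by (simp add: is_path_def)

lemma potential_step:
  assumes T: "IJ_tree I J T" and uv: "adjacent T u v"
    and p: "is_path T v (Inr (Max J)) p" "u \<notin> set p"
  shows "potential T u = step_height h u v + potential T v"
proof -
  have "is_path T u (Inr (Max J)) (u # p)" by (rule is_path_Cons[OF uv p])
  moreover obtain p' where "p = v # p'"
    using p(1) by (cases p) (auto simp: is_path_def)
  ultimately show ?thesis
    using path_height_potential[OF T] p(1) by simp
qed

text \<open>Of the paths from the two ends of the arc to the root, one is the other extended by this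
  arc; which one depends on whether the path from \<open>i\<close> visits
  \<open>bar j\<close>.\<close>

lemma potential_slack:
  assumes T: "IJ_tree I J T" and ij: "(i, j) \<in> T"
  shows "slack (potential T) i j = 0"
proof -
  have "Inl i \<in> node_set I J"
    using ij IJ_tree_arcs[OF T] unfolding arcs_def node_set_def by auto
  then obtain p where p: "is_path T (Inl i) (Inr (Max J)) p"
    using tree_spanning[OF T] reachable_path unfolding spanning_def by blast
  show ?thesis
  proof (cases "Inr j \<in> set p")
    case False
    from potential_step[OF T _ p False] ij show ?thesis unfolding slack_def by simp
  next
    case True
    then obtain q r where qr: "p = q @ Inr j # r" "is_path T (Inr j) (Inr (Max J)) (Inr j # r)"
      using is_path_suffix[OF p] by blast
    then have "Inl i \<notin> set (Inr j # r)"
      using p by (cases q) (auto simp: is_path_def)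
    from potential_step[OF T _ qr(2) this] ij show ?thesis unfolding slack_def by simp
  qed
qed

lemma g_vec_potential: "IJ_tree I J T \<Longrightarrow> k \<in> J \<Longrightarrow> g_vec J h T k = potential T (Inr k)"
  using potential_root unfolding g_vec_def potential_def by auto

lemma g_vec_chart: "g_vec J h T \<in> chart J"
  unfolding g_vec_def chart_def by auto

text \<open>The difference of the two potentials is constant along the arcs of \<open>T\<close> and
  vanishes at the root.\<close>

lemma spanning_potential_unique:
  assumes T: "spanning I J T" and f: "\<And>i j. (i, j) \<in> T \<Longrightarrow> slack f i j = 0"
    and f': "\<And>i j. (i, j) \<in> T \<Longrightarrow> slack f' i j = 0"
    and root: "f (Inr (Max J)) = f' (Inr (Max J))" and v: "v \<in> node_set I J"
  shows "f v = f' v"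
proof -
  have "f v - f' v = f (Inr (Max J)) - f' (Inr (Max J))"
  proof (rule reachable_invariant[of T v _ "\<lambda>v. f v - f' v"])
    show "(adjacent T)\<^sup>*\<^sup>* v (Inr (Max J))" using T v unfolding spanning_def by blast
    show "f (Inl i) - f' (Inl i) = f (Inr j) - f' (Inr j)" if "(i, j) \<in> T" for i j
      using f[OF that] f'[OF that] unfolding slack_def by simp
  qed
  with root show ?thesis by simp
qed

lemma g_vec_eqI:
  assumes T: "IJ_tree I J T" and f: "\<And>i j. (i, j) \<in> T \<Longrightarrow> slack f i j = 0"
    and root: "f (Inr (Max J)) = 0" and x: "x \<in> chart J" "\<And>k. k \<in> J \<Longrightarrow> x k = f (Inr k)"
  shows "g_vec J h T = x"
proof
  fix k
  show "g_vec J h T k = x k"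
  proof (cases "k \<in> J")
    case True
    have "potential T (Inr k) = f (Inr k)"
    proof (rule spanning_potential_unique[OF tree_spanning[OF T]])
      show "slack (potential T) i j = 0" "slack f i j = 0" if "(i, j) \<in> T" for i j
        using potential_slack[OF T that] f[OF that] .
      show "potential T (Inr (Max J)) = f (Inr (Max J))"
        using root potential_root[OF T] by simp
      show "Inr k \<in> node_set I J"
        using True unfolding node_set_def by simp
    qed
    with True x g_vec_potential[OF T] show ?thesis by simp
  next
    case False
    with x(1) g_vec_chart[of T] show ?thesis unfolding chart_def by auto
  qed
qed

section \<open>Tree potentials are feasible\<close>

definition crossers :: "(nat \<times> nat) set \<Rightarrow> nat \<Rightarrow> nat \<Rightarrow> (nat \<times> nat) set" where
  "crossers T a b = {(p, q) \<in> T. p < a \<and> a \<le> q \<and> q < b \<or> a < p \<and> p \<le> b \<and> b < q}"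

text \<open>
  Uncrossing \<open>(a, b)\<close> with an arc of the tree bounds its slack from below by the slacks of two arcs
  that cross fewer arcs of the tree.
\<close>

lemma tree_slack:
  assumes T: "IJ_tree I J T" and f: "\<And>i j. (i, j) \<in> T \<Longrightarrow> slack f i j = 0"
    and ab: "(a, b) \<in> arcs I J"
  shows "0 \<le> slack f a b \<and> (slack f a b = 0 \<longrightarrow> (a, b) \<in> T)"
  using ab
proof (induction "card (crossers T a b)" arbitrary: a b rule: less_induct)
  case less
  have fin: "finite (crossers T a b)" for a b
    using finite_subset[OF IJ_tree_arcs[OF T] finite_arcs]
    by (rule rev_finite_subset) (auto simp: crossers_def)
  note nc = noncrossingD[OF IJ_tree_noncrossing[OF T]]
  have IH: "0 \<le> slack f a' b'" if "crossers T a' b' \<subset> crossers T a b" "(a', b') \<in> arcs I J" for a' b'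
    using less.hyps[OF psubset_card_mono[OF fin that(1)] that(2)] by simp
  show ?case
  proof (cases "(a, b) \<in> T")
    case True
    with f show ?thesis by simp
  next
    case False
    then obtain c d where cd: "(c, d) \<in> T"
      "c < a \<and> a \<le> d \<and> d < b \<or> a < c \<and> c \<le> b \<and> b < d"
      using IJ_tree_memI[OF T, of a b] less.prems unfolding arcs_def by auto
    have arc: "(c, d) \<in> arcs I J" using cd IJ_tree_arcs[OF T] by auto
    have mem: "(c, d) \<in> crossers T a b" "(c, d) \<notin> crossers T c b" "(c, d) \<notin> crossers T a d"
      using cd unfolding crossers_def by auto
    have arcs': "(c, b) \<in> arcs I J" "(a, d) \<in> arcs I J"
      using cd arc less.prems unfolding arcs_def by auto
    \<comment> \<open>An arc crossing \<open>(c, b)\<close> or \<open>(a, d)\<close> but not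
      \<open>(a, b)\<close> would cross \<open>(c, d)\<close>, which is excluded in
      \<open>T\<close>. Since \<open>(c, d)\<close> itself no longer counts, both sets of crossing
      arcs are strictly smaller.\<close>
    have sub: "e \<in> crossers T a b" if "e \<in> crossers T c b \<or> e \<in> crossers T a d" for e
    proof -
      obtain p q where e: "e = (p, q)" by (cases e)
      have pq: "(p, q) \<in> T" using that e unfolding crossers_def by auto
      have no: "\<not> (p < c \<and> c \<le> q \<and> q < d)" "\<not> (c < p \<and> p \<le> d \<and> d < q)"
        using nc[OF pq cd(1)] nc[OF cd(1) pq] by auto
      have "p < a \<and> a \<le> q \<and> q < b \<or> a < p \<and> p \<le> b \<and> b < q"
        using that no cd(2) unfolding e crossers_def by auto
      with pq show ?thesis unfolding e crossers_def by auto
    qed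
    have "0 \<le> slack f c b" "0 \<le> slack f a d"
      using sub mem arcs' by (auto intro!: IH)
    moreover have "slack f c b + slack f a d < slack f c d + slack f a b"
      using cd(2) slack_less[OF arc less.prems, of f] slack_less[OF less.prems arc, of f] by auto
    ultimately show ?thesis using f[OF cd(1)] by simp
  qed
qed

lemma tree_feasible:
  "IJ_tree I J T \<Longrightarrow> (\<And>i j. (i, j) \<in> T \<Longrightarrow> slack f i j = 0) \<Longrightarrow> feasible f"
  using tree_slack unfolding feasible_def by blast

lemma tree_feasible_tight:
  "IJ_tree I J T \<Longrightarrow> (\<And>i j. (i, j) \<in> T \<Longrightarrow> slack f i j = 0) \<Longrightarrow>
    (a, b) \<in> arcs I J \<Longrightarrow> slack f a b = 0 \<Longrightarrow> (a, b) \<in> T"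
  using tree_slack by blast

section \<open>Flips and edges\<close>

lemma slack_tilt:
  "slack (\<lambda>v. f v + c * of_bool (v \<in> B)) i j =
     slack f i j + c * (of_bool (Inl i \<in> B) - of_bool (Inr j \<in> B))"
  unfolding slack_def by (simp add: algebra_simps)

text \<open>\<open>B\<close> is the side of the removed arc that does not contain the root \<open>bar (Max J)\<close>.\<close>

lemma increasing_flip_shift:
  assumes flip: "increasing_flip I J T T'"
  obtains i j i' j' B t where "IJ_tree I J T" "IJ_tree I J T'" "(i, j) \<in> T"
    "(i', j') \<in> arcs I J" "(i', j') \<notin> T" "T' = insert (i', j') (T - {(i, j)})"
    "Inl i \<notin> B" "Inr j \<in> B" "Inl i' \<in> B" "Inr j' \<notin> B" "Inr (Max J) \<notin> B"
    "\<And>c d. (c, d) \<in> T - {(i, j)} \<Longrightarrow> Inl c \<in> B \<longleftrightarrow> Inr d \<in> B"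
    "\<And>c. c \<in> I \<Longrightarrow> \<exists>d. (c, d) \<in> T - {(i, j)}"
    "0 < t" "t = slack (potential T) i' j'"
    "\<And>k. k \<in> J \<Longrightarrow> g_vec J h T' k = g_vec J h T k - t * of_bool (Inr k \<in> B)"
proof -
  obtain i j i' j' where T: "IJ_tree I J T" and T': "IJ_tree I J T'"
    and e: "(i, j) \<in> T" "(i, j') \<in> T" "(i', j) \<in> T" "(i', j') \<notin> T"
    and lt: "i < i'" "i' \<le> j" "j < j'" and T'_eq: "T' = insert (i', j') (T - {(i, j)})"
    using flip by (rule increasing_flipE)
  note nc' = noncrossingD[OF IJ_tree_noncrossing[OF T']]
  have arc: "(i', j') \<in> arcs I J" using T'_eq IJ_tree_arcs[OF T'] by auto
  have arc0: "(i, j) \<in> arcs I J" using e IJ_tree_arcs[OF T] by auto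
  have "j' \<in> J" using arc unfolding arcs_def by auto
  define B where "B = inner_side T i j"
  \<comment> \<open>A neighbour \<open>b < j\<close> of \<open>i\<close> with
    \<open>i' \<le> b\<close> would give an arc \<open>(i, b)\<close> of \<open>T'\<close> that
    crosses the new arc.\<close>
  have i'B: "Inl i' \<in> B"
    using lt nc'[of i _ i' j'] T'_eq unfolding B_def by force
  have sides: "Inl i \<notin> B" "Inr j \<in> B" "Inr j' \<notin> B" "Inr (Max J) \<notin> B"
    using lt le_Max[OF \<open>j' \<in> J\<close>] unfolding B_def by auto
  have cut: "Inl c \<in> B \<longleftrightarrow> Inr d \<in> B" if "(c, d) \<in> T - {(i, j)}" for c d
    using that arcs_le[OF IJ_tree_arcs[OF T]] unfolding B_def
    by (intro inner_side_cut[OF IJ_tree_noncrossing[OF T] e(1,2) lt(3)]) auto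
  have left: "\<exists>d. (c, d) \<in> T - {(i, j)}" if "c \<in> I" for c
  proof (cases "c = i")
    case True
    with e lt show ?thesis by blast
  next
    case False
    with tree_left_nonempty[OF T that] show ?thesis by blast
  qed
  define t where "t = slack (potential T) i' j'"
  \<comment> \<open>The other three arcs of the uncrossing inequality lie in \<open>T\<close> and
    have slack 0.\<close>
  have t: "0 < t"
    using slack_less[OF arc0 arc lt, of "potential T"] potential_slack[OF T] e
    unfolding t_def by auto
  \<comment> \<open>Lowering \<open>B\<close> by \<open>t\<close> keeps the common arcs tight and
    makes the new arc tight, so \<open>f\<close> gives the potential of \<open>T'\<close>.\<close>
  define f where "f v = potential T v + (- t) * of_bool (v \<in> B)" for v
  have f_slack: "slack f a b =
      slack (potential T) a b + (- t) * (of_bool (Inl a \<in> B) - of_bool (Inr b \<in> B))" for a b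
    unfolding f_def by (rule slack_tilt)
  let ?x = "\<lambda>k. if k \<in> J then g_vec J h T k - t * of_bool (Inr k \<in> B) else 0"
  have "g_vec J h T' = ?x"
  proof (rule g_vec_eqI[OF T'])
    show "slack f c d = 0" if "(c, d) \<in> T'" for c d
    proof (cases "(c, d) \<in> T - {(i, j)}")
      case True
      with cut[OF True] potential_slack[OF T] show ?thesis
        unfolding f_slack by simp
    next
      case False
      with that T'_eq have "c = i'" "d = j'" by auto
      with i'B sides show ?thesis unfolding f_slack by (simp add: t_def)
    qed
    show "f (Inr (Max J)) = 0" using sides potential_root[OF T] unfolding f_def by simp
    show "?x \<in> chart J"
      using sides g_vec_chart[of T] unfolding chart_def by auto
    show "?x k = f (Inr k)" if "k \<in> J" for k
      using that g_vec_potential[OF T] unfolding f_def by simp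
  qed
  then have g': "g_vec J h T' k = g_vec J h T k - t * of_bool (Inr k \<in> B)" if "k \<in> J" for k
    using that by simp
  show thesis
    by (rule that[OF T T' e(1) arc e(4) T'_eq sides(1,2) i'B sides(3,4) cut left t t_def g'])
qed

section \<open>Monotonicity of \<open>phi\<close> and covering relations\<close>

text \<open>No coordinate increases, and the one at the right end \<open>j\<close> of the removed
  arc strictly decreases.\<close>

lemma phi_increasing_flip:
  assumes "increasing_flip I J T T'"
  shows "phi J (g_vec J h T) < phi J (g_vec J h T')"
  using assms
proof (rule increasing_flip_shift)
  fix i j i' j' B t
  assume *: "IJ_tree I J T" "(i, j) \<in> T" "Inr j \<in> B" "Inr (Max J) \<notin> B" "0 < t"
    "\<And>k. k \<in> J \<Longrightarrow> g_vec J h T' k = g_vec J h T k - t * of_bool (Inr k \<in> B)"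
  have "j \<in> J - {Max J}"
    using * IJ_tree_arcs[OF *(1)] unfolding arcs_def by auto
  moreover have "g_vec J h T' j < g_vec J h T j"
    using calculation * by simp
  moreover have "\<forall>k\<in>J - {Max J}. g_vec J h T' k \<le> g_vec J h T k"
    using * by simp
  ultimately show ?thesis
    unfolding phi_def neg_less_iff_less using finite_J by (intro sum_strict_mono_ex1) auto
qed

lemma phi_increasing_flips:
  assumes "(increasing_flip I J)\<^sup>*\<^sup>* T T'"
  shows "T = T' \<or> phi J (g_vec J h T) < phi J (g_vec J h T')"
  using assms by (induction rule: rtranclp_induct) (auto dest: phi_increasing_flip)

lemma tamari_le_antisym: "tamari_le I J T T' \<Longrightarrow> tamari_le I J T' T \<Longrightarrow> T = T'"
  unfolding tamari_le_def using phi_increasing_flips[of T T'] phi_increasing_flips[of T' T] by auto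

text \<open>A cover is the first flip of its own chain. Conversely, let \<open>S\<close> lie
  strictly between \<open>T\<close> and its flip \<open>T'\<close>: the first flip from
  \<open>T\<close> towards \<open>S\<close> leads to a tree dominated by \<open>T'\<close>, hence to
  \<open>T'\<close> itself, so \<open>S\<close> would also lie above \<open>T'\<close>.\<close>

lemma tamari_covers_iff_increasing_flip:
  "tamari_covers I J T T' \<longleftrightarrow> increasing_flip I J T T'"
proof
  assume cov: "tamari_covers I J T T'"
  then have "(increasing_flip I J)\<^sup>*\<^sup>* T T'" "T \<noteq> T'"
    unfolding tamari_covers_def tamari_le_def by auto
  then obtain S where S: "increasing_flip I J T S" "(increasing_flip I J)\<^sup>*\<^sup>* S T'"
    by (auto elim: converse_rtranclpE)
  then have "tamari_le I J T S" "tamari_le I J S T'"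
    using cov increasing_flip_trees[OF S(1)] unfolding tamari_covers_def tamari_le_def by auto
  with cov have "S = T \<or> S = T'" unfolding tamari_covers_def by blast
  with S phi_increasing_flip[OF S(1)] show "increasing_flip I J T T'" by auto
next
  assume flip: "increasing_flip I J T T'"
  then have le: "tamari_le I J T T'"
    unfolding tamari_le_def using increasing_flip_trees by blast
  have "S = T \<or> S = T'" if S: "tamari_le I J T S" "tamari_le I J S T'" for S
  proof (rule disjCI)
    assume "S \<noteq> T'"
    show "S = T"
    proof (rule ccontr)
      assume "S \<noteq> T"
      with S(1) obtain U where U: "increasing_flip I J T U" "(increasing_flip I J)\<^sup>*\<^sup>* U S"
        unfolding tamari_le_def by (auto elim: converse_rtranclpE)
      have "(increasing_flip I J)\<^sup>*\<^sup>* U T'"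
        using U(2) S(2) unfolding tamari_le_def by auto
      then have "U = T'"
        using increasing_flip_unique[OF flip U(1)] increasing_flips_dominated by blast
      with U(2) S(1) le have "tamari_le I J T' S"
        unfolding tamari_le_def by auto
      with S(2) \<open>S \<noteq> T'\<close> tamari_le_antisym show False by blast
    qed
  qed
  with le phi_increasing_flip[OF flip] show "tamari_covers I J T T'"
    unfolding tamari_covers_def by auto
qed

section \<open>The cell belonging to a flip\<close>

text \<open>The common arcs leave one degree of freedom, the amount by which \<open>B\<close> is
  lowered. The slack of the removed arc bounds it below by 0, that of the new arc bounds it above by
  \<open>t\<close>.\<close>

lemma increasing_flip_cell:
  assumes flip: "increasing_flip I J T T'"
  shows "{z \<in> chart J. T \<inter> T' \<subseteq> tight z} = segment_between (g_vec J h T) (g_vec J h T')"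
    and "\<exists>x\<in>chart J. tight x = T \<inter> T'"
proof -
  obtain i j i' j' B t where T: "IJ_tree I J T" and T': "IJ_tree I J T'" and ij: "(i, j) \<in> T"
    and arc: "(i', j') \<in> arcs I J" and new: "(i', j') \<notin> T"
    and T'_eq: "T' = insert (i', j') (T - {(i, j)})"
    and sides: "Inl i \<notin> B" "Inr j \<in> B" "Inl i' \<in> B" "Inr j' \<notin> B" "Inr (Max J) \<notin> B"
    and cut: "\<And>c d. (c, d) \<in> T - {(i, j)} \<Longrightarrow> Inl c \<in> B \<longleftrightarrow> Inr d \<in> B"
    and left: "\<And>c. c \<in> I \<Longrightarrow> \<exists>d. (c, d) \<in> T - {(i, j)}"
    and t: "0 < t" "t = slack (potential T) i' j'"
    and g': "\<And>k. k \<in> J \<Longrightarrow> g_vec J h T' k = g_vec J h T k - t * of_bool (Inr k \<in> B)"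
    by (rule increasing_flip_shift[OF flip]) metis
  have common: "T \<inter> T' = T - {(i, j)}"
    using T'_eq new ij by auto
  have arcs_T: "T \<subseteq> arcs I J" by (rule IJ_tree_arcs[OF T])
  \<comment> \<open>Interpolates between the potential of \<open>T\<close> at \<open>l = 0\<close>
    and that of \<open>T'\<close> at \<open>l = 1\<close>.\<close>
  define f where "f l v = potential T v + (- (l * t)) * of_bool (v \<in> B)" for l v
  let ?z = "\<lambda>l k. (1 - l) * g_vec J h T k + l * g_vec J h T' k"
  have f_slack: "slack (f l) a b =
      slack (potential T) a b + (- (l * t)) * (of_bool (Inl a \<in> B) - of_bool (Inr b \<in> B))" for l a b
    unfolding f_def by (rule slack_tilt)
  have f_conv: "slack (f l) a b = (1 - l) * slack (f 0) a b + l * slack (f 1) a b" for l a b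
    unfolding f_slack by (simp add: algebra_simps)
  have f_common: "slack (f l) a b = 0" if "(a, b) \<in> T - {(i, j)}" for l a b
    using that cut[OF that] potential_slack[OF T] unfolding f_slack by simp
  have f0: "slack (f 0) a b = 0" if "(a, b) \<in> T" for a b
    using potential_slack[OF T that] unfolding f_slack by simp
  have f1: "slack (f 1) a b = 0" if "(a, b) \<in> T'" for a b
  proof (cases "(a, b) \<in> T - {(i, j)}")
    case False
    with that T'_eq have "a = i'" "b = j'" by auto
    with sides t show ?thesis unfolding f_slack by simp
  qed (rule f_common)
  have feas01: "feasible (f 0)" "feasible (f 1)"
    using tree_feasible[OF T f0] tree_feasible[OF T' f1] by auto
  have feas: "feasible (f l)" if "0 \<le> l" "l \<le> 1" for l
    using feas01 that unfolding feasible_def by (force simp: f_conv[of l])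
  have z: "?z l k = f l (Inr k)" if "k \<in> J" for l k
    unfolding g'[OF that] g_vec_potential[OF T that] f_def by (simp add: algebra_simps)
  have z_tight: "(a, b) \<in> tight (?z l) \<longleftrightarrow> (a, b) \<in> arcs I J \<and> slack (f l) a b = 0"
    if "0 \<le> l" "l \<le> 1" for l a b
  proof (cases "a \<in> I")
    case True
    then obtain d where "(a, d) \<in> T - {(i, j)}" using left by blast
    with f_common arcs_T show ?thesis
      by (intro tight_iff feas that z) auto
  next
    case False
    then show ?thesis unfolding tight_def arcs_def by auto
  qed
  have z_common: "T \<inter> T' \<subseteq> tight (?z l)" if "0 \<le> l" "l \<le> 1" for l
    unfolding common
  proof (rule subrelI)
    fix a b assume ab: "(a, b) \<in> T - {(i, j)}"
    with arcs_T have "(a, b) \<in> arcs I J" by auto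
    with f_common[OF ab] show "(a, b) \<in> tight (?z l)"
      unfolding z_tight[OF that] by simp
  qed
  have z_chart: "?z l \<in> chart J" for l
    using g_vec_chart[of T] g_vec_chart[of T'] unfolding chart_def by auto
  show "{z \<in> chart J. T \<inter> T' \<subseteq> tight z} = segment_between (g_vec J h T) (g_vec J h T')"
  proof (intro equalityI subsetI)
    fix x assume "x \<in> segment_between (g_vec J h T) (g_vec J h T')"
    then obtain l where l: "x = ?z l" "0 \<le> l" "l \<le> 1"
      unfolding segment_between_def by auto
    then have "T \<inter> T' \<subseteq> tight x"
      using z_common by blast
    with l(1) z_chart show "x \<in> {z \<in> chart J. T \<inter> T' \<subseteq> tight z}" by simp
  next
    fix x assume "x \<in> {z \<in> chart J. T \<inter> T' \<subseteq> tight z}"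
    then have x: "x \<in> chart J" "T - {(i, j)} \<subseteq> tight x" unfolding common by auto
    \<comment> \<open>Raising \<open>B\<close> by \<open>s\<close> makes \<open>(i, j)\<close> tight
      again and so recovers the potential of \<open>T\<close>; hence \<open>s / t\<close> is the
      parameter of \<open>x\<close> on the segment.\<close>
    define s where "s = slack (lift x) i j"
    have s: "0 \<le> s"
      using feasible_lift[of x] ij arcs_T unfolding s_def feasible_def by auto
    define f' where "f' v = lift x v + s * of_bool (v \<in> B)" for v
    have f'_slack: "slack f' a b =
        slack (lift x) a b + s * (of_bool (Inl a \<in> B) - of_bool (Inr b \<in> B))" for a b
      unfolding f'_def by (rule slack_tilt)
    have eq: "f' v = potential T v" if "v \<in> node_set I J" for v
    proof (rule spanning_potential_unique[OF tree_spanning[OF T] _ potential_slack[OF T] _ that])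
      show "slack f' a b = 0" if "(a, b) \<in> T" for a b
      proof (cases "(a, b) = (i, j)")
        case True
        with sides show ?thesis unfolding f'_slack by (simp add: s_def)
      next
        case False
        then have "(a, b) \<in> T - {(i, j)}" using that by auto
        with x(2) cut[OF this] tight_lift show ?thesis unfolding f'_slack by auto
      qed
      show "f' (Inr (Max J)) = potential T (Inr (Max J))"
        using sides x(1) potential_root[OF T] unfolding f'_def chart_def by simp
    qed
    have "slack f' i' j' = t"
      using eq[of "Inl i'"] eq[of "Inr j'"] arc t unfolding slack_def node_set_def arcs_def by auto
    moreover have "slack f' i' j' = slack (lift x) i' j' + s"
      using sides unfolding f'_slack by simp
    ultimately have "s \<le> t"
      using feasible_lift[of x] arc unfolding feasible_def by auto
    have "x k = ?z (s / t) k" for k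
    proof (cases "k \<in> J")
      case True
      then have "f' (Inr k) = potential T (Inr k)" by (intro eq) (simp add: node_set_def)
      then have "x k = potential T (Inr k) - s * of_bool (Inr k \<in> B)"
        unfolding f'_def by simp
      with z[OF True, of "s / t"] t(1) show ?thesis unfolding f_def by simp
    next
      case False
      with x(1) z_chart[of "s / t"] show ?thesis unfolding chart_def by auto
    qed
    with s \<open>s \<le> t\<close> t(1) show "x \<in> segment_between (g_vec J h T) (g_vec J h T')"
      unfolding segment_between_def by (auto intro!: exI[of _ "s / t"])
  qed
  \<comment> \<open>At the midpoint a slack is the mean of two nonnegative slacks; it vanishes only
    if both do, that is, for arcs of both trees.\<close>
  have "(a, b) \<in> T \<inter> T'" if ab: "(a, b) \<in> tight (?z (1/2))" for a b
  proof -
    have *: "(a, b) \<in> arcs I J" "slack (f (1/2)) a b = 0"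
      using ab z_tight[of "1/2"] by auto
    then have "0 \<le> slack (f 0) a b" "0 \<le> slack (f 1) a b"
      using feas01 unfolding feasible_def by auto
    with * have "slack (f 0) a b = 0" "slack (f 1) a b = 0"
      using f_conv[of "1/2" a b] by auto
    with * show ?thesis
      using tree_feasible_tight[OF T f0] tree_feasible_tight[OF T' f1] by auto
  qed
  moreover have "T \<inter> T' \<subseteq> tight (?z (1/2))"
    by (rule z_common) simp_all
  ultimately have "tight (?z (1/2)) = T \<inter> T'" by auto
  with z_chart show "\<exists>x\<in>chart J. tight x = T \<inter> T'" by blast
qed

lemma bounded_segment:
  assumes "x \<in> chart J" "y \<in> chart J"
  shows "bounded_points (segment_between x y)"
  unfolding bounded_points_def
proof (intro exI ballI allI)
  fix z k assume "z \<in> segment_between x y"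
  then obtain l where l: "z = (\<lambda>k. (1 - l) * x k + l * y k)" "0 \<le> l" "l \<le> 1"
    unfolding segment_between_def by auto
  show "\<bar>z k\<bar> \<le> (\<Sum>k\<in>J. \<bar>x k\<bar> + \<bar>y k\<bar>)"
  proof (cases "k \<in> J")
    case True
    have "\<bar>z k\<bar> \<le> \<bar>(1 - l) * x k\<bar> + \<bar>l * y k\<bar>"
      unfolding l(1) by (rule abs_triangle_ineq)
    also have "\<dots> \<le> \<bar>x k\<bar> + \<bar>y k\<bar>"
      using l(2,3) by (intro add_mono) (auto simp: abs_mult intro: mult_left_le_one_le)
    also have "\<dots> \<le> (\<Sum>k\<in>J. \<bar>x k\<bar> + \<bar>y k\<bar>)"
      using True finite_J by (intro member_le_sum) auto
    finally show ?thesis .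
  next
    case False
    with assms have "z k = 0" unfolding l(1) chart_def by auto
    then show ?thesis by (simp add: sum_nonneg)
  qed
qed

lemma increasing_flip_edge:
  assumes flip: "increasing_flip I J T T'"
  shows "segment_between (g_vec J h T) (g_vec J h T') \<in> associahedron_edges I J h"
proof -
  let ?E = "segment_between (g_vec J h T) (g_vec J h T')"
  obtain x where x: "x \<in> chart J" "tight x = T \<inter> T'"
    using increasing_flip_cell(2)[OF flip] by blast
  have E: "?E = cell_of I J h x"
    using increasing_flip_cell(1)[OF flip] unfolding cell_of_eq x(2) by simp
  have "bounded_points (cell_of I J h x)"
    using bounded_segment[OF g_vec_chart g_vec_chart] unfolding E[symmetric] .
  with x(1) E have "?E \<in> associahedron I J h"
    unfolding associahedron_def by blast
  moreover have "one_dimensional ?E"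
    unfolding one_dimensional_def
  proof
    have "?E \<subseteq> {(\<lambda>k. g_vec J h T k + t * (g_vec J h T' k - g_vec J h T k)) | t. True}"
      unfolding segment_between_def by (auto simp: algebra_simps)
    then show "\<exists>a d. ?E \<subseteq> {(\<lambda>k. a k + t * d k) | t. True}"
      by (intro exI[of _ "g_vec J h T"] exI[of _ "\<lambda>k. g_vec J h T' k - g_vec J h T k"])
    have "g_vec J h T \<in> ?E" "g_vec J h T' \<in> ?E"
      unfolding segment_between_def by (auto intro: exI[of _ 0] exI[of _ 1])
    moreover have "g_vec J h T \<noteq> g_vec J h T'"
      using phi_increasing_flip[OF flip] by auto
    ultimately show "\<exists>x\<in>?E. \<exists>y\<in>?E. x \<noteq> y" by blast
  qed
  ultimately show ?thesis unfolding associahedron_edges_def by simp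
qed

section \<open>From edges back to flips\<close>

definition move :: "(nat \<Rightarrow> real) \<Rightarrow> (nat + nat \<Rightarrow> real) \<Rightarrow> real \<Rightarrow> nat \<Rightarrow> real" where
  "move x w t k = (if k \<in> J then x k + t * w (Inr k) else 0)"

text \<open>A ratio test: follow the direction \<open>w\<close> until the first further arc becomes
  tight. If there were no such arc, the whole ray would lie in the bounded cell.\<close>

lemma bounded_cell_exit:
  assumes x: "x \<in> chart J" and root: "w (Inr (Max J)) = 0"
    and w: "\<And>i j. (i, j) \<in> tight x \<Longrightarrow> w (Inl i) = w (Inr j)"
    and k: "k \<in> J" "w (Inr k) \<noteq> 0" and bdd: "bounded_points (cell_of I J h x)"
  obtains t i j where "0 < t" "(i, j) \<in> arcs I J" "w (Inl i) < w (Inr j)"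
    "move x w t \<in> cell_of I J h x" "(i, j) \<in> tight (move x w t)"
proof -
  let ?f = "\<lambda>t v. lift x v + t * w v"
  have f: "slack (?f t) i j = slack (lift x) i j - t * (w (Inr j) - w (Inl i))" for t i j
    unfolding slack_def by (simp add: algebra_simps)
  have chart: "move x w t \<in> chart J" for t
    using x root Max_J_in unfolding move_def chart_def by auto
  have wt: "t * w (Inl i) = t * w (Inr j)" if "(i, j) \<in> tight x" for t i j
    using w[OF that] by simp
  have mv: "move x w t j = x j + t * w (Inr j)" if "j \<in> J" for t j
    using that unfolding move_def by simp
  have cell: "move x w t \<in> cell_of I J h x" if "feasible (?f t)" for t
    using shift_cell(2)[OF wt that mv] chart unfolding cell_of_eq by blast
  define K where "K = {(i, j) \<in> arcs I J. w (Inl i) < w (Inr j)}"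
  \<comment> \<open>The time at which the slack of an arc in \<open>K\<close> reaches 0; on all
    other arcs the slack does not decrease.\<close>
  define r where "r = (\<lambda>(i, j). slack (lift x) i j / (w (Inr j) - w (Inl i)))"
  have fin: "finite (r ` K)"
    using finite_arcs unfolding K_def by (intro finite_imageI) (rule rev_finite_subset, auto)
  have nonneg: "0 \<le> slack (lift x) i j" if "(i, j) \<in> arcs I J" for i j
    using feasible_lift[of x] that unfolding feasible_def by auto
  have feas: "feasible (?f t)" if t: "0 \<le> t" "\<And>e. e \<in> K \<Longrightarrow> t \<le> r e" for t
    unfolding feasible_def
  proof clarify
    fix i j assume ij: "(i, j) \<in> arcs I J"
    show "0 \<le> slack (?f t) i j"
    proof (cases "w (Inl i) < w (Inr j)")
      case True
      with ij t(2)[of "(i, j)"] have "t \<le> slack (lift x) i j / (w (Inr j) - w (Inl i))"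
        unfolding K_def r_def by simp
      with True show ?thesis unfolding f by (simp add: pos_le_divide_eq)
    next
      case False
      with t(1) have "t * (w (Inr j) - w (Inl i)) \<le> 0" by (intro mult_nonneg_nonpos) auto
      with nonneg[OF ij] show ?thesis unfolding f by simp
    qed
  qed
  have "K \<noteq> {}"
  proof
    assume "K = {}"
    obtain b where b: "\<And>y k. y \<in> cell_of I J h x \<Longrightarrow> \<bar>y k\<bar> \<le> b"
      using bdd unfolding bounded_points_def by blast
    \<comment> \<open>Chosen so that coordinate \<open>k\<close> moves by
      \<open>\<bar>b\<bar> + \<bar>x k\<bar> + 1\<close>, which takes it past the bound
      \<open>b\<close>.\<close>
    define t where "t = (\<bar>b\<bar> + \<bar>x k\<bar> + 1) / \<bar>w (Inr k)\<bar>"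
    have "0 \<le> t" unfolding t_def by simp
    then have "\<bar>x k + t * w (Inr k)\<bar> \<le> b"
      using b[OF cell[OF feas], of t k] \<open>K = {}\<close> mv[OF k(1)] by auto
    moreover have "\<bar>t * w (Inr k)\<bar> = \<bar>b\<bar> + \<bar>x k\<bar> + 1"
      using k(2) unfolding t_def by (simp add: abs_mult)
    ultimately show False by linarith
  qed
  define t where "t = Min (r ` K)"
  have le: "\<And>e. e \<in> K \<Longrightarrow> t \<le> r e"
    using fin unfolding t_def by simp
  have "t \<in> r ` K"
    using fin \<open>K \<noteq> {}\<close> unfolding t_def by (intro Min_in) auto
  then obtain i j where ij: "(i, j) \<in> arcs I J" "w (Inl i) < w (Inr j)"
    "t = slack (lift x) i j / (w (Inr j) - w (Inl i))"
    unfolding K_def r_def by auto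
  have "slack (lift x) i j \<noteq> 0"
    using w[of i j] ij tight_lift[of i j x] by auto
  with nonneg[OF ij(1)] ij have t: "0 < t" by (simp add: order_le_neq_trans)
  have ft: "feasible (?f t)" using t le by (intro feas) auto
  have "slack (?f t) i j = 0" using ij unfolding f by simp
  then have "(i, j) \<in> tight (move x w t)"
    using shift_cell(1)[OF wt ft mv] ij(1) by blast
  with t ij cell[OF ft] show thesis by (intro that) auto
qed

lemma adjacent_mono: "G \<subseteq> S \<Longrightarrow> (adjacent G)\<^sup>*\<^sup>* u v \<Longrightarrow> (adjacent S)\<^sup>*\<^sup>* u v"
  by (rule rtranclp_mono[THEN predicate2D, rotated])
    (auto elim!: adjacentE)

lemma edge_increasing_flip:
  assumes E: "E \<in> associahedron_edges I J h"
  shows "\<exists>T T'. increasing_flip I J T T' \<and> E = segment_between (g_vec J h T) (g_vec J h T')"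
proof -
  obtain x where x: "x \<in> chart J" and E_eq: "E = cell_of I J h x"
    and bdd: "bounded_points (cell_of I J h x)"
    using E unfolding associahedron_edges_def associahedron_def by auto
  obtain a d p q where line: "E \<subseteq> {(\<lambda>k. a k + t * d k) | t. True}"
    and pq: "p \<in> E" "q \<in> E" "p \<noteq> q"
    using E unfolding associahedron_edges_def one_dimensional_def by auto
  define G where "G = tight x"
  have cell: "E = {y \<in> chart J. G \<subseteq> tight y}"
    unfolding E_eq cell_of_eq G_def ..
  let ?root = "Inr (Max J)"
  define N where "N = {v \<in> node_set I J. \<not> (adjacent G)\<^sup>*\<^sup>* v ?root}"
  have nodes: "Inl i \<in> node_set I J" "Inr j \<in> node_set I J" if "(i, j) \<in> arcs I J" for i j
    using that unfolding node_set_def arcs_def by auto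
  have G_arcs: "G \<subseteq> arcs I J" unfolding G_def by (rule tight_arcs)
  have step: "(adjacent G)\<^sup>*\<^sup>* (Inl i) v \<longleftrightarrow> (adjacent G)\<^sup>*\<^sup>* (Inr j) v" if "(i, j) \<in> G" for i j v
    using that by (meson adjacent.simps(1,2) converse_rtranclp_into_rtranclp)
  have N_step: "Inl i \<in> N \<longleftrightarrow> Inr j \<in> N" if "(i, j) \<in> G" for i j
    using step[OF that] nodes[of i j] that G_arcs unfolding N_def by auto
  have root_N: "?root \<notin> N" unfolding N_def by simp
  have to_J: "\<exists>k\<in>J. (adjacent G)\<^sup>*\<^sup>* v (Inr k)" if v: "v \<in> node_set I J" for v
  proof (cases v)
    case (Inl i)
    with v obtain j where j: "(i, j) \<in> G"
      using tight_left_nonempty[of i x] unfolding G_def node_set_def by auto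
    with G_arcs have "j \<in> J" unfolding arcs_def by auto
    with j Inl show ?thesis by (auto intro!: bexI[of _ j])
  next
    case (Inr k)
    with v show ?thesis unfolding node_set_def by auto
  qed
  \<comment> \<open>Otherwise \<open>G\<close> is connected, its potentials are determined by the
    value at the root, and the cell is a single point.\<close>
  have "\<exists>k\<in>J. Inr k \<in> N"
  proof (rule ccontr)
    assume none: "\<not> (\<exists>k\<in>J. Inr k \<in> N)"
    have "spanning I J G"
      unfolding spanning_def
    proof
      fix v assume "v \<in> node_set I J"
      then obtain k where k: "k \<in> J" "(adjacent G)\<^sup>*\<^sup>* v (Inr k)" using to_J by blast
      moreover have "(adjacent G)\<^sup>*\<^sup>* (Inr k) ?root"
        using none k(1) unfolding N_def node_set_def by auto
      ultimately show "(adjacent G)\<^sup>*\<^sup>* v ?root" by simp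
    qed
    note span = this
    have tight: "slack (lift y) i j = 0" if "y \<in> E" "(i, j) \<in> G" for y i j
      using that tight_lift[of i j y] unfolding cell by auto
    have root: "lift y ?root = 0" if "y \<in> E" for y
      using that unfolding cell chart_def by simp
    have "lift p (Inr k) = lift q (Inr k)" if "k \<in> J" for k
    proof (rule spanning_potential_unique[OF span tight[OF pq(1)] tight[OF pq(2)]])
      show "lift p ?root = lift q ?root" using root[OF pq(1)] root[OF pq(2)] by simp
      show "Inr k \<in> node_set I J" using that unfolding node_set_def by simp
    qed
    moreover have "p k = q k" if "k \<notin> J" for k
      using pq that unfolding cell chart_def by auto
    ultimately have "p = q" by (auto simp: fun_eq_iff)
    with pq(3) show False by contradiction
  qed
  then obtain k0 where k0: "k0 \<in> J" "Inr k0 \<in> N" by blast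
  \<comment> \<open>Moving \<open>N\<close> up yields a new tight arc with its right end in
    \<open>N\<close>, moving it down one with its left end in \<open>N\<close>.\<close>
  let ?w = "\<lambda>v. of_bool (v \<in> N) :: real"
  obtain t1 i j where 1: "0 < t1" "(i, j) \<in> arcs I J" "?w (Inl i) < ?w (Inr j)"
    "move x ?w t1 \<in> E" "(i, j) \<in> tight (move x ?w t1)"
    unfolding E_eq
    by (rule bounded_cell_exit[OF x _ _ k0(1) _ bdd, where w = ?w])
      (use root_N N_step k0 in \<open>auto simp: G_def\<close>)
  let ?w' = "\<lambda>v. - of_bool (v \<in> N) :: real"
  obtain t2 i' j' where 2: "0 < t2" "(i', j') \<in> arcs I J" "?w' (Inl i') < ?w' (Inr j')"
    "move x ?w' t2 \<in> E" "(i', j') \<in> tight (move x ?w' t2)"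
    unfolding E_eq
    by (rule bounded_cell_exit[OF x _ _ k0(1) _ bdd, where w = ?w'])
      (use root_N N_step k0 in \<open>auto simp: G_def\<close>)
  have ij: "Inl i \<notin> N" "Inr j \<in> N" and ij': "Inl i' \<in> N" "Inr j' \<notin> N"
    using 1(3) 2(3) by (auto split: if_splits simp: of_bool_def)
  have on_line: "\<exists>s. \<forall>k. y k = a k + s * d k" if "y \<in> E" for y
    using line that by auto
  have "x \<in> E" using x unfolding cell G_def by simp
  \<comment> \<open>The component \<open>D\<close> of \<open>k\<close> can be moved on its own. On a
    line, this motion is parallel to that of \<open>N\<close>, which changes coordinate
    \<open>l\<close>; so \<open>l\<close> moves with \<open>D\<close> and belongs to it.\<close>
  have connJ: "(adjacent G)\<^sup>*\<^sup>* (Inr l) (Inr k)"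
    if k: "k \<in> J" "Inr k \<in> N" and l: "l \<in> J" "Inr l \<in> N" for k l
  proof -
    define D where "D = {v. (adjacent G)\<^sup>*\<^sup>* v (Inr k)}"
    let ?v = "\<lambda>v. of_bool (v \<in> D) :: real"
    have root_D: "?root \<notin> D"
      using k reachable_commute unfolding D_def N_def by auto
    have D_step: "Inl i \<in> D \<longleftrightarrow> Inr j \<in> D" if "(i, j) \<in> G" for i j
      using step[OF that] unfolding D_def by simp
    have kD: "Inr k \<in> D" unfolding D_def by simp
    obtain t3 where 3: "0 < t3" "move x ?v t3 \<in> E"
      unfolding E_eq
      by (rule bounded_cell_exit[OF x _ _ k(1) _ bdd, where w = ?v])
        (use root_D D_step kD in \<open>auto simp: G_def\<close>)
    obtain s0 s1 s3 where s: "\<And>k. x k = a k + s0 * d k"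
      "\<And>k. move x ?w t1 k = a k + s1 * d k" "\<And>k. move x ?v t3 k = a k + s3 * d k"
      using on_line[OF \<open>x \<in> E\<close>] on_line[OF 1(4)] on_line[OF 3(2)] by metis
    have "t3 = (s3 - s0) * d k"
      using s(1)[of k] s(3)[of k] k kD unfolding move_def by (simp add: algebra_simps)
    moreover have "t1 = (s1 - s0) * d l"
      using s(1)[of l] s(2)[of l] l unfolding move_def by (simp add: algebra_simps)
    ultimately have "(s3 - s0) * d l \<noteq> 0" using 1(1) 3(1) by auto
    moreover have "t3 * ?v (Inr l) = (s3 - s0) * d l"
      using s(1)[of l] s(3)[of l] l unfolding move_def by (simp add: algebra_simps)
    ultimately have "Inr l \<in> D" by (cases "Inr l \<in> D") auto
    then show ?thesis unfolding D_def by simp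
  qed
  have conn: "(adjacent G)\<^sup>*\<^sup>* u v" if u: "u \<in> N" and v: "v \<in> N" for u v
  proof -
    have *: "\<exists>k\<in>J. (adjacent G)\<^sup>*\<^sup>* u (Inr k) \<and> Inr k \<in> N" if u: "u \<in> N" for u
    proof -
      obtain k where k: "k \<in> J" "(adjacent G)\<^sup>*\<^sup>* u (Inr k)"
        using u to_J unfolding N_def by blast
      have "Inr k \<in> N"
        using u k unfolding N_def node_set_def by (auto dest: rtranclp_trans)
      with k show ?thesis by blast
    qed
    obtain k l where "k \<in> J" "(adjacent G)\<^sup>*\<^sup>* u (Inr k)" "Inr k \<in> N"
      "l \<in> J" "(adjacent G)\<^sup>*\<^sup>* v (Inr l)" "Inr l \<in> N"
      using *[OF u] *[OF v] by blast
    then show ?thesis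
      using connJ[of l k] reachable_commute[of G v "Inr l"] by (meson rtranclp_trans)
  qed
  \<comment> \<open>As \<open>N\<close> is a single component, one arc leaving it connects
    everything to the root.\<close>
  have span: "spanning I J S" if S: "G \<subseteq> S" and uv: "u \<in> N" "v \<notin> N" "v \<in> node_set I J" "adjacent S u v"
    for S u v
    unfolding spanning_def
  proof
    fix z assume z: "z \<in> node_set I J"
    have v: "(adjacent S)\<^sup>*\<^sup>* v ?root"
      using uv by (intro adjacent_mono[OF S]) (auto simp: N_def)
    show "(adjacent S)\<^sup>*\<^sup>* z ?root"
    proof (cases "z \<in> N")
      case True
      with conn uv(1) have "(adjacent S)\<^sup>*\<^sup>* z u" by (intro adjacent_mono[OF S])
      also note r_into_rtranclp[of "adjacent S", OF uv(4)]
      also note v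
      finally show ?thesis .
    next
      case False
      with z show ?thesis by (intro adjacent_mono[OF S]) (auto simp: N_def)
    qed
  qed
  have vertex: "IJ_tree I J S \<and> noncrossing S \<and> g_vec J h S = y"
    if S: "S = insert e G" "spanning I J S" and y: "y \<in> E" "e \<in> tight y" for S e y
  proof -
    have sub: "S \<subseteq> tight y" using S y unfolding cell by auto
    then have nc: "noncrossing S" and arcs: "S \<subseteq> arcs I J"
      using noncrossing_subset[OF tight_noncrossing] tight_arcs by blast+
    have tree: "IJ_tree I J S" by (rule spanning_IJ_tree[OF arcs nc S(2)])
    have "g_vec J h S = y"
    proof (rule g_vec_eqI[OF tree])
      show "slack (lift y) i j = 0" if "(i, j) \<in> S" for i j
        using that sub tight_lift[of i j y] by auto
      show "lift y ?root = 0" "y \<in> chart J" "\<And>k. y k = lift y (Inr k)"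
        using y(1) unfolding cell chart_def by auto
    qed
    with tree nc show ?thesis by simp
  qed
  let ?T = "insert (i, j) G" and ?T' = "insert (i', j') G"
  have T: "IJ_tree I J ?T" "noncrossing ?T" "g_vec J h ?T = move x ?w t1"
    using vertex[OF refl span[OF _ ij(2,1)] 1(4,5)] nodes[OF 1(2)] by auto
  have T': "IJ_tree I J ?T'" "noncrossing ?T'" "g_vec J h ?T' = move x ?w' t2"
    using vertex[OF refl span[OF _ ij'(1,2)] 2(4,5)] nodes[OF 2(2)] by auto
  have new: "(i, j) \<notin> G" "(i', j') \<notin> G" "(i, j) \<noteq> (i', j')"
    using ij ij' N_step by auto
  \<comment> \<open>By maximality of \<open>?T\<close> some arc of it crosses
    \<open>(i', j')\<close>; arcs of \<open>G\<close> do not, as \<open>?T'\<close> is noncrossing,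
    so the two new arcs cross each other.\<close>
  have "(i', j') \<notin> ?T" using new by auto
  then obtain c e where ce: "(c, e) \<in> ?T"
    "c < i' \<and> i' \<le> e \<and> e < j' \<or> i' < c \<and> c \<le> j' \<and> j' < e"
    using IJ_tree_memI[OF T(1), of i' j'] 2(2) unfolding arcs_def by auto
  have "(c, e) \<notin> G"
    using ce(2) noncrossingD[OF T'(2), of c e i' j'] noncrossingD[OF T'(2), of i' j' c e] by auto
  with ce have cross: "i < i' \<and> i' \<le> j \<and> j < j' \<or> i' < i \<and> i \<le> j' \<and> j' < j" by auto
  have "increasing_flip I J ?T ?T'"
    using cross
  proof
    assume lt: "i < i' \<and> i' \<le> j \<and> j < j'"
    have "?T' = insert (i', j') (?T - {(i, j)})" using new by auto
    with lt T(1) T'(1) show ?thesis unfolding increasing_flip_def by blast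
  next
    assume lt: "i' < i \<and> i \<le> j' \<and> j' < j"
    have "?T = insert (i, j) (?T' - {(i', j')})" using new by auto
    with lt T(1) T'(1) have "increasing_flip I J ?T' ?T" unfolding increasing_flip_def by blast
    \<comment> \<open>The opposite orientation is impossible: \<open>?T\<close> arises by raising
      coordinates and \<open>?T'\<close> by lowering them, so \<open>phi\<close> is not larger at
      \<open>?T\<close>.\<close>
    from phi_increasing_flip[OF this] have "phi J (move x ?w' t2) < phi J (move x ?w t1)"
      unfolding T(3) T'(3) .
    moreover have "(\<Sum>k\<in>J - {Max J}. move x ?w' t2 k) \<le> (\<Sum>k\<in>J - {Max J}. move x ?w t1 k)"
      using 1(1) 2(1) by (intro sum_mono) (auto simp: move_def)
    ultimately show ?thesis unfolding phi_def by simp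
  qed
  moreover have "?T \<inter> ?T' = G" using new by auto
  ultimately show ?thesis
    using increasing_flip_cell(1)[of ?T ?T'] unfolding cell by metis
qed

end

theorem theorem5p11:
  fixes I J :: "nat set" and h :: "nat \<Rightarrow> nat \<Rightarrow> real"
  assumes "admissible_pair I J"
    and "height_function I J h"
  shows "(\<forall>T T'. IJ_tree I J T \<and> IJ_tree I J T' \<and> increasing_flip I J T T' \<longrightarrow>
            phi J (g_vec J h T) < phi J (g_vec J h T'))
       \<and> (\<forall>E\<in>associahedron_edges I J h.
            \<exists>T T'. tamari_covers I J T T' \<and>
                   E = segment_between (g_vec J h T) (g_vec J h T') \<and>
                   phi J (g_vec J h T) < phi J (g_vec J h T'))
       \<and> (\<forall>T T'. tamari_covers I J T T' \<longrightarrow>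
            segment_between (g_vec J h T) (g_vec J h T') \<in> associahedron_edges I J h \<and>
            phi J (g_vec J h T) < phi J (g_vec J h T'))"
proof -
  interpret height_data I J h
    using assms by unfold_locales
  show ?thesis
    unfolding tamari_covers_iff_increasing_flip
    using phi_increasing_flip edge_increasing_flip increasing_flip_edge by blast
qed

end
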